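(* Let $P_\lambda$ and $P_\mu$ be Poisson PP distributions with sigma-finite intensity measures $\lambda$ and $\mu$ on a measurable space $(S,\mathcal S)$. Then the Hellinger distance between $P_\lambda$ and $P_\mu$ is given by $$H^2(P_\lambda,P_\mu)=1-e^{-H^2(\lambda,\mu)}.$$
   Context: Point patterns: $N(S)$ is the set of measures on $(S,\mathcal S)$ that can be written as a countable sum of integer-valued finite measures, equipped with the sigma-algebra $\mathcal N(S)$ generated by the evaluation maps $\eta\mapsto\eta(B)$, $B\in\mathcal S$. Poisson PP distribution: for a sigma-finite measure $\lambda$ on $(S,\mathcal S)$, $P_\lambda$ is the unique probability measure on $(N(S),\mathcal N(S))$ under which $\eta(B_1),\dots,\eta(B_n)$ are independent for all $n\ge1$ and mutually disjoint $B_1,\dots,B_n\in\mathcal S$, and $\eta(B)$ is Poisson distributed with mean $\lambda(B)$ for every $B\in\mathcal S$ (with $\mathrm{Poi}(0)=\delta_0$, $\mathrm{Poi}(\infty)=\delta_\infty$). Hellinger distance of sigma-finite measures $\lambda,\mu$ on a measurable space (in particular of probability measures): $H(\lambda,\mu)=\left(\frac12\int(\sqrt f-\sqrt g)^2\,d\nu\right)^{1/2}\in[0,\infty]$, where $f,g$ are densities of $\lambda,\mu$ with respect to a sigma-finite measure $\nu$ (the value does not depend on the choice). Convention: $e^{-\infty}=0$. *)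

theory Defs
  imports "HOL-Probability.Probability"
begin

section \<open>Extended nonnegative reals\<close>

definition sqrt_ennreal :: "ennreal \<Rightarrow> ennreal" where
  "sqrt_ennreal x = (if x = \<infinity> then \<infinity> else ennreal (sqrt (enn2real x)))"

definition exp_neg_ennreal :: "ennreal \<Rightarrow> ennreal" where
  "exp_neg_ennreal x = (if x = \<infinity> then 0 else ennreal (exp (- enn2real x)))"

lemma sqrt_ennreal_power2: "(sqrt_ennreal x)\<^sup>2 = x"
proof (cases x)
  case (real r)
  then show ?thesis
    by (simp add: sqrt_ennreal_def ennreal_power)
qed (simp add: sqrt_ennreal_def)


section \<open>Point patterns\<close>

definition point_patterns :: "'a measure \<Rightarrow> 'a measure set" where
  "point_patterns S = {\<eta>. sets \<eta> = sets S \<and>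
     (\<exists>\<xi> :: nat \<Rightarrow> 'a measure.
        (\<forall>n. sets (\<xi> n) = sets S \<and> finite_measure (\<xi> n) \<and>
             (\<forall>B\<in>sets S. \<exists>k::nat. emeasure (\<xi> n) B = of_nat k)) \<and>
        (\<forall>B\<in>sets S. emeasure \<eta> B = (\<Sum>n. emeasure (\<xi> n) B)))}"

definition point_pattern_space :: "'a measure \<Rightarrow> 'a measure measure" where
  "point_pattern_space S = sigma (point_patterns S)
     {(\<lambda>\<eta>. emeasure \<eta> B) -` A \<inter> point_patterns S | B A. B \<in> sets S \<and> A \<in> sets borel}"


section \<open>Poisson distributions\<close>

text \<open>The Poisson distribution with mean in \<open>[0, \<infinity>]\<close>, as a law on \<open>[0, \<infinity>]\<close>.
  The boundary cases are separated because \<^const>\<open>poisson_pmf\<close> is specified for positive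
  rates only.\<close>

definition poisson_ennreal :: "ennreal \<Rightarrow> ennreal measure" where
  "poisson_ennreal c =
     (if c = 0 then return borel 0
      else if c = \<infinity> then return borel \<infinity>
      else distr (measure_pmf (poisson_pmf (enn2real c))) borel of_nat)"

definition poisson_PP :: "'a measure \<Rightarrow> 'a measure \<Rightarrow> 'a measure measure \<Rightarrow> bool" where
  "poisson_PP S \<Lambda> P \<longleftrightarrow>
     prob_space P \<and> sets P = sets (point_pattern_space S) \<and>
     (\<forall>n\<ge>1. \<forall>B :: nat \<Rightarrow> 'a set.
        (\<forall>i<n. B i \<in> sets S) \<longrightarrow> disjoint_family_on B {..<n} \<longrightarrow>
        prob_space.indep_vars P (\<lambda>_. borel) (\<lambda>i \<eta>. emeasure \<eta> (B i)) {..<n}) \<and>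
     (\<forall>B\<in>sets S. distr P borel (\<lambda>\<eta>. emeasure \<eta> B) = poisson_ennreal (emeasure \<Lambda> B))"


section \<open>Hellinger distance\<close>

text \<open>Densities of sigma-finite measures are a.e. finite, so they can be taken real-valued.\<close>

definition hellinger_dominated ::
    "'a measure \<Rightarrow> 'a measure \<Rightarrow> 'a measure \<Rightarrow> ('a \<Rightarrow> real) \<Rightarrow> ('a \<Rightarrow> real) \<Rightarrow> bool" where
  "hellinger_dominated L M \<nu> f g \<longleftrightarrow>
     sigma_finite_measure \<nu> \<and>
     f \<in> borel_measurable \<nu> \<and> (\<forall>x. 0 \<le> f x) \<and> density \<nu> (\<lambda>x. ennreal (f x)) = L \<and>
     g \<in> borel_measurable \<nu> \<and> (\<forall>x. 0 \<le> g x) \<and> density \<nu> (\<lambda>x. ennreal (g x)) = M"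

definition hellinger_wrt :: "'a measure \<Rightarrow> ('a \<Rightarrow> real) \<Rightarrow> ('a \<Rightarrow> real) \<Rightarrow> ennreal" where
  "hellinger_wrt \<nu> f g =
     sqrt_ennreal ((\<integral>\<^sup>+x. ennreal ((sqrt (f x) - sqrt (g x))\<^sup>2) \<partial>\<nu>) / 2)"

definition hellinger :: "'a measure \<Rightarrow> 'a measure \<Rightarrow> ennreal" where
  "hellinger L M =
     (THE h. \<exists>\<nu> f g. hellinger_dominated L M \<nu> f g \<and> h = hellinger_wrt \<nu> f g)"

lemma hellinger_wrt_unique:
  assumes 1: "hellinger_dominated L M \<nu> f g" and 2: "hellinger_dominated L M \<nu>' f' g'"
  shows "hellinger_wrt \<nu> f g = hellinger_wrt \<nu>' f' g'"
proof -
  note d1 = 1[unfolded hellinger_dominated_def] and d2 = 2[unfolded hellinger_dominated_def]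
  interpret N: sigma_finite_measure \<nu> using d1 by simp
  interpret N': sigma_finite_measure \<nu>' using d2 by simp
  have [measurable]: "f \<in> borel_measurable \<nu>" "g \<in> borel_measurable \<nu>"
    "f' \<in> borel_measurable \<nu>'" "g' \<in> borel_measurable \<nu>'" using d1 d2 by auto
  have sN: "sets \<nu> = sets L" using d1 sets_density by metis
  have sN': "sets \<nu>' = sets L" using d2 sets_density by metis
  have sets_eq: "sets \<nu> = sets \<nu>'" using sN sN' by simp
  have [measurable]: "f \<in> borel_measurable \<nu>'" "g \<in> borel_measurable \<nu>'"
    using \<open>f \<in> borel_measurable \<nu>\<close> \<open>g \<in> borel_measurable \<nu>\<close>
    by (simp_all cong: measurable_cong_sets add: sets_eq[symmetric])
  define I where "I x = (if f x > 0 \<or> g x > 0 then 1 else 0 :: ennreal)" for x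
  have [measurable]: "I \<in> borel_measurable \<nu>" unfolding I_def by measurable
  define K where "K = density \<nu> I"
  have sK: "sets K = sets \<nu>'" using sets_eq by (simp add: K_def)
  have ac: "absolutely_continuous \<nu>' K"
    unfolding absolutely_continuous_def
  proof
    fix A assume A: "A \<in> null_sets \<nu>'"
    have "AE x in \<nu>'. x \<notin> A" using A by (rule AE_not_in)
    then have A0: "AE x in \<nu>'. x \<in> A \<longrightarrow> ennreal (f' x) = 0"
      "AE x in \<nu>'. x \<in> A \<longrightarrow> ennreal (g' x) = 0" by auto
    have AL: "A \<in> null_sets L"
      using A A0(1) d2 null_sets_density_iff[of "\<lambda>x. ennreal (f' x)" \<nu>' A] by auto
    have AM: "A \<in> null_sets M"
      using A A0(2) d2 null_sets_density_iff[of "\<lambda>x. ennreal (g' x)" \<nu>' A] by auto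
    have "A \<in> sets \<nu>" using A sets_eq by auto
    have "AE x in \<nu>. x \<in> A \<longrightarrow> ennreal (f x) = 0"
      using AL d1 null_sets_density_iff[of "\<lambda>x. ennreal (f x)" \<nu> A] by auto
    moreover have "AE x in \<nu>. x \<in> A \<longrightarrow> ennreal (g x) = 0"
      using AM d1 null_sets_density_iff[of "\<lambda>x. ennreal (g x)" \<nu> A] by auto
    ultimately have "AE x in \<nu>. x \<in> A \<longrightarrow> I x = 0"
      by eventually_elim (auto simp: I_def ennreal_eq_0_iff)
    then show "A \<in> null_sets K"
      using \<open>A \<in> sets \<nu>\<close> by (auto simp: K_def null_sets_density_iff)
  qed
  obtain h where [measurable]: "h \<in> borel_measurable \<nu>'" and h: "density \<nu>' h = K"
    using N'.Radon_Nikodym[OF ac sK] by blast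
  have "sigma_finite_measure K"
    unfolding K_def by (subst N.sigma_finite_iff_density_finite) (auto simp: I_def)
  then have hfin: "AE x in \<nu>'. h x \<noteq> \<infinity>"
    using N'.sigma_finite_iff_density_finite[of h] h by simp
  have key: "AE x in \<nu>'. h x * ennreal (u x) = ennreal (u' x)"
    if [measurable]: "u \<in> borel_measurable \<nu>" "u' \<in> borel_measurable \<nu>'"
      and eq: "density \<nu> (\<lambda>x. ennreal (u x)) = density \<nu>' (\<lambda>x. ennreal (u' x))"
      and uI: "\<And>x. I x * ennreal (u x) = ennreal (u x)" for u u' :: "'a \<Rightarrow> real"
  proof -
    have [measurable]: "u \<in> borel_measurable \<nu>'"
      using \<open>u \<in> borel_measurable \<nu>\<close>
      by (simp cong: measurable_cong_sets add: sets_eq[symmetric])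
    have "density \<nu>' (\<lambda>x. h x * ennreal (u x)) = density K (\<lambda>x. ennreal (u x))"
      unfolding h[symmetric] by (subst density_density_eq) auto
    also have "\<dots> = density \<nu> (\<lambda>x. ennreal (u x))"
      unfolding K_def by (subst density_density_eq) (auto simp: uI)
    finally show ?thesis
      using N'.density_unique_iff[of "\<lambda>x. h x * ennreal (u x)" "\<lambda>x. ennreal (u' x)"] eq by auto
  qed
  have kf: "AE x in \<nu>'. h x * ennreal (f x) = ennreal (f' x)"
    by (rule key) (use d1 d2 in \<open>auto simp: I_def ennreal_eq_0_iff not_less\<close>)
  have kg: "AE x in \<nu>'. h x * ennreal (g x) = ennreal (g' x)"
    by (rule key) (use d1 d2 in \<open>auto simp: I_def ennreal_eq_0_iff not_less\<close>)
  let ?D = "\<lambda>f g x. ennreal ((sqrt (f x) - sqrt (g x))\<^sup>2)"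
  have "(\<integral>\<^sup>+x. ?D f g x \<partial>\<nu>) = (\<integral>\<^sup>+x. I x * ?D f g x \<partial>\<nu>)"
  proof (rule nn_integral_cong)
    fix x
    have "f x = 0 \<and> g x = 0" if "\<not> (f x > 0 \<or> g x > 0)"
      using that d1 by (auto simp: not_less intro: order.antisym)
    then show "?D f g x = I x * ?D f g x" by (auto simp: I_def)
  qed
  also have "\<dots> = (\<integral>\<^sup>+x. ?D f g x \<partial>K)"
    unfolding K_def by (subst nn_integral_density) auto
  also have "\<dots> = (\<integral>\<^sup>+x. h x * ?D f g x \<partial>\<nu>')"
    unfolding h[symmetric] by (subst nn_integral_density) auto
  also have "\<dots> = (\<integral>\<^sup>+x. ?D f' g' x \<partial>\<nu>')"
  proof (rule nn_integral_cong_AE)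
    show "AE x in \<nu>'. h x * ?D f g x = ?D f' g' x"
      using hfin kf kg
    proof eventually_elim
      case (elim x)
      then obtain r where r: "h x = ennreal r" "0 \<le> r" by (cases "h x") auto
      have "f' x = r * f x" "g' x = r * g x"
        using elim r d1 d2 by (auto simp: ennreal_mult[symmetric])
      then show ?case
        using r by (simp add: ennreal_mult[symmetric] real_sqrt_mult
            right_diff_distrib[symmetric] power_mult_distrib)
    qed
  qed
  finally show ?thesis by (simp add: hellinger_wrt_def)
qed

lemma hellinger_eq:
  assumes "hellinger_dominated L M \<nu> f g"
  shows "hellinger L M = hellinger_wrt \<nu> f g"
  unfolding hellinger_def
  by (rule the_equality) (use assms hellinger_wrt_unique in blast)+

end

theory Submission
  imports Defs
begin

text \<open>The squared Hellinger distance of two probability measures is one minus their affinity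
  \<open>\<integral> sqrt (p q)\<close>, and by the AM-GM inequality the affinity is the infimum of
  \<open>(\<integral> \<psi> dP + \<integral> 1/\<psi> dQ) / 2\<close> over positive weights \<open>\<psi>\<close>. Restricting \<open>\<psi>\<close> to functions of the
  counts of disjoint sets \<open>B\<^sub>1, \<dots>, B\<^sub>n\<close> of finite intensity gives the affinity of two products
  of Poisson laws, \<open>exp (- (\<Sum>i. (sqrt (\<lambda> B\<^sub>i) - sqrt (\<mu> B\<^sub>i))\<^sup>2) / 2)\<close>. The exponents are at most
  \<open>H\<^sup>2(\<lambda>, \<mu>)\<close> by Cauchy-Schwarz and come arbitrarily close to it on level sets of the density
  of \<open>\<lambda>\<close> with respect to \<open>\<lambda> + \<mu>\<close>. Since functions of finitely many counts are dense in \<open>L\<^sup>1\<close>,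
  the restriction does not change the infimum.\<close>

section \<open>Poisson laws as densities\<close>

text \<open>The two laws may be mutually singular, so a formula for the density of one with respect
  to the other cannot be the starting point. In the variational form a weight enters only through
  one integral against each law; for a weight depending on counts of disjoint sets, only the
  explicit joint law of the counts matters. The two inequalities use this in opposite ways. For the
  upper bound on the affinity one fine partition suffices, as passing to counts cannot lower the
  affinity. For the lower bound a near-optimal weight has to be replaced by a function of counts
  without losing control of its reciprocal. Densities with respect to
  \<open>P\<^sub>\<Lambda> + P\<^sub>M\<close> lie in [0,1]; after a small shift \<delta> the weight
  stays between two positive constants, and there the functional is Lipschitz in L1. Sets of
  infinite intensity are avoided because their count is a.s. infinite, a law singular to every
  Poisson law of finite mean; sigma-finiteness makes the remaining sets sufficient. If the
  intensities have infinite distance, the upper bound alone decides.\<close>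

definition poisson_base :: "ennreal measure" where
  "poisson_base = distr (measure_pmf (poisson_pmf 1)) borel of_nat"

text \<open>The ratio of e^(-a) a^n / n! to the mass e^(-1) / n! of Poi(1). The reference law Poi(1)
  charges every count, so it dominates all Poisson laws of finite mean, including the point mass at
  0. It is a probability measure, so its finite products are finite measures. The floor reads the
  count n off its copy in \<open>ennreal\<close>; other arguments form a null set.\<close>

definition poisson_dens :: "real \<Rightarrow> ennreal \<Rightarrow> real" where
  "poisson_dens a y = exp (1 - a) * a ^ nat \<lfloor>enn2real y\<rfloor>"

lemma sets_poisson_base [simp, measurable_cong]: "sets poisson_base = sets borel"
  by (simp add: poisson_base_def)

lemma prob_space_poisson_base: "prob_space poisson_base"
  unfolding poisson_base_def by (rule prob_space.prob_space_distr) (auto intro: measure_pmf.prob_space_axioms)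

lemma poisson_dens_measurable [measurable]: "poisson_dens a \<in> borel_measurable borel"
  unfolding poisson_dens_def by measurable

lemma poisson_dens_nonneg: "0 \<le> a \<Longrightarrow> 0 \<le> poisson_dens a y"
  by (simp add: poisson_dens_def)

lemma poisson_dens_of_nat: "poisson_dens a (of_nat n) = exp (1 - a) * a ^ n"
  by (simp add: poisson_dens_def)

lemma poisson_ennreal_eq_density:
  assumes "0 \<le> a"
  shows "poisson_ennreal (ennreal a) = density poisson_base (\<lambda>y. ennreal (poisson_dens a y))"
proof -
  have "density poisson_base (\<lambda>y. ennreal (poisson_dens a y)) =
     distr (density (measure_pmf (poisson_pmf 1)) (\<lambda>n. ennreal (exp (1 - a) * a ^ n))) borel of_nat"
    unfolding poisson_base_def by (subst density_distr) (auto simp: poisson_dens_of_nat)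
  also have "density (measure_pmf (poisson_pmf 1)) (\<lambda>n. ennreal (exp (1 - a) * a ^ n)) =
      density (count_space UNIV) (\<lambda>n. ennreal (a ^ n / fact n * exp (- a)))"
    unfolding measure_pmf_eq_density using assms
    by (subst density_density_eq)
      (auto simp: ennreal_mult[symmetric] exp_diff exp_minus field_simps intro!: density_cong)
  also have "distr \<dots> borel of_nat = poisson_ennreal (ennreal a)"
  \<comment> \<open>At a = 0 the target is a point mass by definition. The density formula agrees
    with it because 0^0 = 1 while all later terms vanish.\<close>
  proof (cases "a = 0")
    case True
    have "(density (count_space UNIV) (\<lambda>n. ennreal (a ^ n / fact n * exp (- a)))) = return (count_space UNIV) (0::nat)"
    proof (rule measure_eqI)
      fix X :: "nat set"
      have "emeasure (density (count_space UNIV) (\<lambda>n. ennreal (a ^ n / fact n * exp (- a)))) X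
         = (\<integral>\<^sup>+n. indicator X 0 * indicator {0} n \<partial>count_space (UNIV :: nat set))"
      proof (subst emeasure_density)
        have "ennreal (a ^ n / fact n * exp (- a)) * indicator X n = indicator X 0 * indicator {0} n"
          for n :: nat
          using True by (cases n) (auto simp: indicator_def)
        then show "(\<integral>\<^sup>+n. ennreal (a ^ n / fact n * exp (- a)) * indicator X n \<partial>count_space UNIV) =
            (\<integral>\<^sup>+n. indicator X 0 * indicator {0} n \<partial>count_space (UNIV :: nat set))"
          by (simp only:)
      qed auto
      also have "\<dots> = indicator X 0" by (subst nn_integral_cmult_indicator) auto
      finally show "emeasure (density (count_space UNIV) (\<lambda>n. ennreal (a ^ n / fact n * exp (- a)))) X = emeasure (return (count_space UNIV) 0) X"
        by simp
    qed simp
    then show ?thesis using True by (simp add: poisson_ennreal_def distr_return)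
  next
    case False
    then show ?thesis using assms
      by (simp add: poisson_ennreal_def measure_pmf_eq_density)
  qed
  finally show ?thesis ..
qed

text \<open>The geometric mean of the two Poisson masses is e^(-(a+b)/2) c^n / n! with c = sqrt(a
  b). Summing the exponential series leaves the exponent c - (a+b)/2, which is minus half of the
  squared difference of the roots.\<close>

lemma nn_integral_sqrt_poisson_dens:
  assumes "0 \<le> a" "0 \<le> b"
  shows "(\<integral>\<^sup>+y. ennreal (sqrt (poisson_dens a y * poisson_dens b y)) \<partial>poisson_base) =
    ennreal (exp (- ((sqrt a - sqrt b)\<^sup>2 / 2)))"
proof -
  define c where "c = sqrt (a * b)"
  define k where "k = exp (- (a + b) / 2)"
  have c: "0 \<le> c" using assms by (simp add: c_def)
  have sq: "sqrt (exp (1-a) * a ^ n * (exp (1-b) * b ^ n)) = exp 1 * k * c ^ n" for n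
  proof (rule real_sqrt_unique)
    have "(exp 1 * k * c ^ n)\<^sup>2 = (exp 1 * k)\<^sup>2 * (c\<^sup>2) ^ n"
      by (simp add: power_mult_distrib power_mult[symmetric] mult.commute)
    also have "(exp 1 * k)\<^sup>2 = exp (1-a) * exp (1-b)"
      by (simp add: k_def power2_eq_square mult_exp_exp field_simps)
    also have "c\<^sup>2 = a * b" using assms by (simp add: c_def)
    finally show "(exp 1 * k * c ^ n)\<^sup>2 = exp (1-a) * a ^ n * (exp (1-b) * b ^ n)"
      by (simp add: power_mult_distrib)
  qed (use c in \<open>simp add: k_def\<close>)
  have "(\<integral>\<^sup>+y. ennreal (sqrt (poisson_dens a y * poisson_dens b y)) \<partial>poisson_base)
     = (\<integral>\<^sup>+n. ennreal (k * (c ^ n / fact n)) \<partial>count_space UNIV)"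
    unfolding poisson_base_def measure_pmf_eq_density
    by (subst nn_integral_distr; simp add: nn_integral_density poisson_dens_of_nat sq)
       (auto intro!: nn_integral_cong simp: ennreal_mult[symmetric] k_def c field_simps exp_minus)
  also have "\<dots> = (\<Sum>n. ennreal (k * (c ^ n / fact n)))"
    by (simp add: nn_integral_count_space_nat)
  also have "\<dots> = ennreal (k * exp c)"
  proof (rule suminf_ennreal_eq)
    have "(\<lambda>n. c ^ n / fact n) sums exp c"
      using exp_converges[of c] by (simp add: field_simps)
    then show "(\<lambda>n. k * (c ^ n / fact n)) sums (k * exp c)" by (rule sums_mult)
  qed (use c in \<open>simp add: k_def\<close>)
  also have "k * exp c = exp (- ((sqrt a - sqrt b)\<^sup>2 / 2))"
    using assms by (simp add: k_def c_def mult_exp_exp power2_diff real_sqrt_mult field_simps)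
  finally show ?thesis .
qed

section \<open>Affinity and weights\<close>

text \<open>The common dominating measure, used both for the two intensities and for the two laws.
  It is meant for measures on the same sigma-algebra, which is taken from the first
  argument.\<close>

definition sum_measure :: "'a measure \<Rightarrow> 'a measure \<Rightarrow> 'a measure" where
  "sum_measure L M = measure_of (space L) (sets L) (\<lambda>A. emeasure L A + emeasure M A)"

lemma sets_sum_measure [simp, measurable_cong]: "sets (sum_measure L M) = sets L"
  by (simp add: sum_measure_def sets.space_closed sets.sigma_sets_eq)

lemma space_sum_measure [simp]: "space (sum_measure L M) = space L"
  by (rule sets_eq_imp_space_eq) simp

lemma emeasure_sum_measure:
  assumes "sets M = sets L" "A \<in> sets L"
  shows "emeasure (sum_measure L M) A = emeasure L A + emeasure M A"
proof (rule emeasure_measure_of[OF sum_measure_def])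
  show "countably_additive (sets (sum_measure L M)) (\<lambda>A. emeasure L A + emeasure M A)"
  proof (rule countably_additiveI)
    fix A :: "nat \<Rightarrow> 'a set"
    assume "range A \<subseteq> sets (sum_measure L M)" "disjoint_family A"
    then show "(\<Sum>i. emeasure L (A i) + emeasure M (A i)) = emeasure L (\<Union>i. A i) + emeasure M (\<Union>i. A i)"
      using assms by (subst suminf_add[symmetric]) (auto simp: suminf_emeasure)
  qed
qed (use assms sets.space_closed in \<open>auto simp: positive_def\<close>)

lemma sigma_finite_sum_measure:
  assumes "sigma_finite_measure L" "sigma_finite_measure M" and [simp]: "sets M = sets L"
  shows "sigma_finite_measure (sum_measure L M)"
proof -
  interpret L: sigma_finite_measure L by fact
  interpret M: sigma_finite_measure M by fact
  have [simp]: "space M = space L" by (rule sets_eq_imp_space_eq) simp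
  obtain A where A: "countable A" "A \<subseteq> sets L" "\<Union>A = space L" "\<forall>a\<in>A. emeasure L a \<noteq> \<infinity>"
    using L.sigma_finite_countable by blast
  obtain B where B: "countable B" "B \<subseteq> sets L" "\<Union>B = space L" "\<forall>b\<in>B. emeasure M b \<noteq> \<infinity>"
    using M.sigma_finite_countable by auto
  show ?thesis
  proof
    show "\<exists>C. countable C \<and> C \<subseteq> sets (sum_measure L M) \<and> \<Union>C = space (sum_measure L M) \<and>
        (\<forall>c\<in>C. emeasure (sum_measure L M) c \<noteq> \<infinity>)"
    proof (intro exI[of _ "(\<lambda>(a, b). a \<inter> b) ` (A \<times> B)"] conjI ballI)
      show "\<Union>((\<lambda>(a, b). a \<inter> b) ` (A \<times> B)) = space (sum_measure L M)"
        using A(3) B(3) by (auto simp: set_eq_iff)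
      fix c assume "c \<in> (\<lambda>(a, b). a \<inter> b) ` (A \<times> B)"
      then obtain a b where ab: "a \<in> A" "b \<in> B" "c = a \<inter> b" by auto
      have m: "a \<in> sets L" "b \<in> sets L" using ab A B by auto
      have "emeasure L c \<le> emeasure L a" "emeasure M c \<le> emeasure M b"
        using m ab by (auto intro!: emeasure_mono)
      then show "emeasure (sum_measure L M) c \<noteq> \<infinity>"
        using m ab A(4) B(4) by (auto simp: emeasure_sum_measure top_unique)
    qed (use A B in auto)
  qed
qed

text \<open>The two Radon-Nikodym derivatives add up to 1 almost everywhere by uniqueness of
  densities. The form f, 1 - f with bounds valid everywhere is what the level sets of f and the
  bounds on the weights rely on later.\<close>

lemma density_sum_measure:
  assumes "sigma_finite_measure L" "sigma_finite_measure M" and sets: "sets M = sets L"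
  obtains f :: "'a \<Rightarrow> real" where "f \<in> borel_measurable L" "\<And>x. 0 \<le> f x" "\<And>x. f x \<le> 1"
    "density (sum_measure L M) (\<lambda>x. ennreal (f x)) = L"
    "density (sum_measure L M) (\<lambda>x. ennreal (1 - f x)) = M"
proof -
  let ?N = "sum_measure L M"
  interpret N: sigma_finite_measure ?N by (rule sigma_finite_sum_measure) fact+
  have "absolutely_continuous ?N L" "absolutely_continuous ?N M"
    using sets by (auto simp: absolutely_continuous_def null_sets_def emeasure_sum_measure)
  then obtain f g where [measurable]: "f \<in> borel_measurable ?N" "g \<in> borel_measurable ?N"
    and f: "density ?N f = L" and g: "density ?N g = M"
    using N.Radon_Nikodym[of L] N.Radon_Nikodym[of M] sets by auto
  have "density ?N (\<lambda>x. f x + g x) = density ?N (\<lambda>x. 1)"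
  proof (rule measure_eqI)
    fix A assume "A \<in> sets (density ?N (\<lambda>x. f x + g x))"
    then have A[measurable]: "A \<in> sets ?N" by simp
    have "emeasure (density ?N (\<lambda>x. f x + g x)) A =
        emeasure (density ?N f) A + emeasure (density ?N g) A"
      using A by (subst (1 2 3) emeasure_density) (auto simp: nn_integral_add[symmetric] distrib_right)
    then show "emeasure (density ?N (\<lambda>x. f x + g x)) A = emeasure (density ?N (\<lambda>x. 1)) A"
      using A sets by (simp add: f g emeasure_sum_measure density_1)
  qed simp
  then have fg: "AE x in ?N. f x + g x = 1"
    by (subst (asm) N.density_unique_iff) auto
  define F where "F x = enn2real (min 1 (f x))" for x
  have F1: "F x \<le> 1" for x
    unfolding F_def by (rule enn2real_leI) auto
  have AE: "AE x in ?N. ennreal (F x) = f x \<and> ennreal (1 - F x) = g x"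
    using fg
  proof eventually_elim
    case (elim x)
    have "f x \<le> 1" using elim by (metis le_iff_add)
    then obtain r where r: "f x = ennreal r" "0 \<le> r" "r \<le> 1" by (cases "f x") (auto simp: top_unique)
    have "g x \<le> 1" using elim by (metis le_iff_add add.commute)
    then obtain s where s: "g x = ennreal s" "0 \<le> s" by (cases "g x") (auto simp: top_unique)
    have "s = 1 - r"
      using elim r s by (simp flip: ennreal_plus)
    then show ?case using r s by (simp add: F_def min_absorb2)
  qed
  show ?thesis
  proof
    show "F \<in> borel_measurable L" unfolding F_def
      using \<open>f \<in> borel_measurable ?N\<close> by measurable
    then have [measurable]: "F \<in> borel_measurable ?N" by measurable
    have "density ?N (\<lambda>x. ennreal (F x)) = density ?N f"
      by (rule density_cong) (use AE in auto)
    then show "density ?N (\<lambda>x. ennreal (F x)) = L" using f by (rule trans)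
    have "density ?N (\<lambda>x. ennreal (1 - F x)) = density ?N g"
      by (rule density_cong) (use AE in auto)
    then show "density ?N (\<lambda>x. ennreal (1 - F x)) = M" using g by (rule trans)
  qed (use F1 in \<open>auto simp: F_def\<close>)
qed

section \<open>Variational bound for the affinity and monotonicity under maps\<close>

lemma amgm_weighted:
  fixes t :: real assumes "0 \<le> a" "0 \<le> b" "0 < t"
  shows "2 * sqrt (a * b) \<le> t * a + b / t"
proof -
  have "sqrt (a * b) = sqrt ((t * a) * (b / t))" using assms by simp
  also have "\<dots> \<le> (t * a + b / t) / 2"
    using assms by (intro arith_geo_mean_sqrt) auto
  finally show ?thesis by simp
qed

lemma nn_integral_weighted_sum:
  assumes [measurable]: "p \<in> borel_measurable N" "q \<in> borel_measurable N" "\<psi> \<in> borel_measurable N"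
    and "\<And>x. 0 \<le> p x" "\<And>x. 0 \<le> q x" "\<And>x. 0 < \<psi> x"
  shows "(\<integral>\<^sup>+x. ennreal (\<psi> x) \<partial>density N (\<lambda>x. ennreal (p x))) +
      (\<integral>\<^sup>+x. ennreal (1 / \<psi> x) \<partial>density N (\<lambda>x. ennreal (q x))) =
    (\<integral>\<^sup>+x. ennreal (\<psi> x * p x + q x / \<psi> x) \<partial>N)"
  using assms
  by (subst (1 2) nn_integral_density)
    (auto simp: ennreal_mult[symmetric] nn_integral_add[symmetric] less_imp_le mult.commute
       simp flip: ennreal_plus intro!: nn_integral_cong)

lemma affinity_le_weighted_sum:
  assumes [measurable]: "p \<in> borel_measurable N" "q \<in> borel_measurable N" "\<psi> \<in> borel_measurable N"
    and "\<And>x. 0 \<le> p x" "\<And>x. 0 \<le> q x" "\<And>x. 0 < \<psi> x"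
  shows "2 * (\<integral>\<^sup>+x. ennreal (sqrt (p x * q x)) \<partial>N) \<le>
     (\<integral>\<^sup>+x. ennreal (\<psi> x) \<partial>density N (\<lambda>x. ennreal (p x))) +
      (\<integral>\<^sup>+x. ennreal (1 / \<psi> x) \<partial>density N (\<lambda>x. ennreal (q x)))"
proof -
  have "2 * (\<integral>\<^sup>+x. ennreal (sqrt (p x * q x)) \<partial>N) = (\<integral>\<^sup>+x. ennreal (2 * sqrt (p x * q x)) \<partial>N)"
    using assms by (subst nn_integral_cmult[symmetric]) (auto simp: ennreal_mult)
  also have "\<dots> \<le> (\<integral>\<^sup>+x. ennreal (\<psi> x * p x + q x / \<psi> x) \<partial>N)"
    using assms by (intro nn_integral_mono ennreal_leI amgm_weighted)
  finally show ?thesis using assms by (simp add: nn_integral_weighted_sum)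
qed

text \<open>The unregularised optimal weight \<open>sqrt (q / p)\<close> can vanish or blow up.\<close>

lemma affinity_near_optimal_weight:
  assumes "finite_measure N"
    and [measurable]: "p \<in> borel_measurable N" "q \<in> borel_measurable N"
    and pq: "\<And>x. 0 \<le> p x" "\<And>x. 0 \<le> q x"
    and int: "(\<integral>\<^sup>+x. ennreal (p x) \<partial>N) \<le> 1" "(\<integral>\<^sup>+x. ennreal (q x) \<partial>N) \<le> 1"
    and e: "0 < e"
  obtains \<delta> :: real where "0 < \<delta>"
    "(\<integral>\<^sup>+x. ennreal (sqrt ((q x + \<delta>) / (p x + \<delta>))) \<partial>density N (\<lambda>x. ennreal (p x))) +
      (\<integral>\<^sup>+x. ennreal (1 / sqrt ((q x + \<delta>) / (p x + \<delta>))) \<partial>density N (\<lambda>x. ennreal (q x)))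
      \<le> 2 * (\<integral>\<^sup>+x. ennreal (sqrt (p x * q x)) \<partial>N) + ennreal e"
proof -
  interpret finite_measure N by fact
  define m where "m = measure N (space N)"
  have m: "0 \<le> m" "emeasure N (space N) = ennreal m"
    by (simp_all add: m_def emeasure_eq_measure)
  \<comment> \<open>The shift will be \<delta> = s^2. The pointwise error 2s(2 + p + q) integrates
    to at most s(4m + 4), as p and q have mass at most 1; the cap at 1 is used to bound s^2 in the
    pointwise estimate.\<close>
  define s where "s = min 1 (e / (4 * m + 4))"
  have s: "0 < s" "s \<le> 1" and "s \<le> e / (4 * m + 4)"
    using e m by (auto simp: s_def)
  then have se: "s * (4 * m + 4) \<le> e"
    using m by (subst (asm) pos_le_divide_eq) auto
  let ?\<psi> = "\<lambda>x. sqrt ((q x + s\<^sup>2) / (p x + s\<^sup>2))"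
  have pos: "0 < ?\<psi> x" for x
    using pq[of x] s by (simp add: add_nonneg_pos)
  \<comment> \<open>With u and v the roots of the shifted densities the weight is v/u. Replacing a
    by u^2 and b by v^2 makes both summands equal to uv, and subadditivity of the root separates
    sqrt(ab) from an error of order s that is integrable because N is finite.\<close>
  have bound: "?\<psi> x * p x + q x / ?\<psi> x \<le> 2 * sqrt (p x * q x) + 2 * s * (2 + p x + q x)" for x
  proof -
    define a b where "a = p x" and "b = q x"
    have ab: "0 \<le> a" "0 \<le> b" using pq by (auto simp: a_def b_def)
    define u v where "u = sqrt (a + s\<^sup>2)" and "v = sqrt (b + s\<^sup>2)"
    have uv: "0 < u" "0 < v" "u\<^sup>2 = a + s\<^sup>2" "v\<^sup>2 = b + s\<^sup>2"
      using ab s by (auto simp: u_def v_def add_nonneg_pos)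
    have "v / u * a \<le> v / u * u\<^sup>2" using uv by (intro mult_left_mono) auto
    moreover have "b / (v / u) \<le> v\<^sup>2 / (v / u)" using uv by (intro divide_right_mono) auto
    ultimately have "v / u * a + b / (v / u) \<le> 2 * (u * v)"
      using uv by (simp add: power2_eq_square mult.commute[of u v])
    also have "u * v = sqrt (a * b + s\<^sup>2 * (a + b + s\<^sup>2))"
      by (simp add: u_def v_def real_sqrt_mult[symmetric] algebra_simps)
    also have "\<dots> \<le> sqrt (a * b) + sqrt (s\<^sup>2 * (a + b + s\<^sup>2))"
      using ab by (intro sqrt_add_le_add_sqrt) auto
    also have "sqrt (s\<^sup>2 * (a + b + s\<^sup>2)) = s * sqrt (a + b + s\<^sup>2)"
      using s by (simp add: real_sqrt_mult)
    also have "sqrt (a + b + s\<^sup>2) \<le> 2 + a + b"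
    proof (rule real_le_lsqrt)
      have "s\<^sup>2 \<le> 1" using s by (simp add: power_le_one)
      moreover have "2 + a + b \<le> (2 + a + b)\<^sup>2"
        using ab by (simp add: power2_eq_square)
      ultimately show "a + b + s\<^sup>2 \<le> (2 + a + b)\<^sup>2" by linarith
    qed (use ab in auto)
    finally have "v / u * a + b / (v / u) \<le> 2 * (sqrt (a * b) + s * (2 + a + b))"
      using s by (simp add: mult_left_mono)
    then show ?thesis by (simp add: a_def b_def u_def v_def real_sqrt_divide algebra_simps)
  qed
  have "(\<integral>\<^sup>+x. ennreal (?\<psi> x) \<partial>density N (\<lambda>x. ennreal (p x))) +
      (\<integral>\<^sup>+x. ennreal (1 / ?\<psi> x) \<partial>density N (\<lambda>x. ennreal (q x))) =
      (\<integral>\<^sup>+x. ennreal (?\<psi> x * p x + q x / ?\<psi> x) \<partial>N)"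
    by (rule nn_integral_weighted_sum) (use pq pos in auto)
  also have "\<dots> \<le> (\<integral>\<^sup>+x. ennreal (2 * sqrt (p x * q x) + 2 * s * (2 + p x + q x)) \<partial>N)"
    by (intro nn_integral_mono ennreal_leI bound)
  also have "\<dots> = (\<integral>\<^sup>+x. 2 * ennreal (sqrt (p x * q x)) +
       ennreal (2 * s) * (2 + ennreal (p x) + ennreal (q x)) \<partial>N)"
  proof (intro nn_integral_cong)
    fix x
    have "ennreal (2 * sqrt (p x * q x) + 2 * s * (2 + p x + q x)) =
        ennreal (2 * sqrt (p x * q x)) + ennreal (2 * s * (2 + p x + q x))"
      using pq s by (intro ennreal_plus) auto
    then show "ennreal (2 * sqrt (p x * q x) + 2 * s * (2 + p x + q x)) =
        2 * ennreal (sqrt (p x * q x)) + ennreal (2 * s) * (2 + ennreal (p x) + ennreal (q x))"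
      using pq s by (simp add: ennreal_mult ennreal_plus)
  qed
  also have "\<dots> = 2 * (\<integral>\<^sup>+x. ennreal (sqrt (p x * q x)) \<partial>N) +
      ennreal (2 * s) * (2 * ennreal m + (\<integral>\<^sup>+x. ennreal (p x) \<partial>N) + (\<integral>\<^sup>+x. ennreal (q x) \<partial>N))"
    by (simp add: nn_integral_add nn_integral_cmult m)
  also have "\<dots> \<le> 2 * (\<integral>\<^sup>+x. ennreal (sqrt (p x * q x)) \<partial>N) +
      ennreal (2 * s) * (2 * ennreal m + 1 + 1)"
    using int by (intro add_left_mono mult_left_mono add_mono) auto
  also have "ennreal (2 * s) * (2 * ennreal m + 1 + 1) = ennreal (2 * s * (2 * m + 2))"
    unfolding add.assoc one_add_one using s m by (simp add: ennreal_mult ennreal_plus)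
  also have "\<dots> \<le> ennreal e" using se by (intro ennreal_leI) (simp add: algebra_simps)
  finally show ?thesis using s by (intro that[of "s\<^sup>2"]) (auto intro: add_left_mono)
qed

text \<open>A weight on the target space pulls back along \<open>T\<close> to a weight on the source
  with the same two integrals, so the source has more weights to minimise over. \<open>B\<close> is
  a reference measure for the image laws and need not be an image of \<open>N\<close>; near-optimal
  weights for \<open>u\<close> and \<open>v\<close> are tested on the source.\<close>

lemma affinity_le_affinity_distr:
  assumes [measurable]: "p \<in> borel_measurable N" "q \<in> borel_measurable N"
      "T \<in> N \<rightarrow>\<^sub>M U" "u \<in> borel_measurable B" "v \<in> borel_measurable B"
    and "finite_measure B"
    and pq: "\<And>x. 0 \<le> p x" "\<And>x. 0 \<le> q x" and uv: "\<And>x. 0 \<le> u x" "\<And>x. 0 \<le> v x"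
    and int: "(\<integral>\<^sup>+x. ennreal (u x) \<partial>B) \<le> 1" "(\<integral>\<^sup>+x. ennreal (v x) \<partial>B) \<le> 1"
    and dp: "distr (density N (\<lambda>x. ennreal (p x))) U T = density B (\<lambda>x. ennreal (u x))"
    and dq: "distr (density N (\<lambda>x. ennreal (q x))) U T = density B (\<lambda>x. ennreal (v x))"
  shows "(\<integral>\<^sup>+x. ennreal (sqrt (p x * q x)) \<partial>N) \<le> (\<integral>\<^sup>+x. ennreal (sqrt (u x * v x)) \<partial>B)"
proof -
  have UB [measurable_cong]: "sets U = sets B" using arg_cong[OF dp, of sets] by simp
  have "2 * (\<integral>\<^sup>+x. ennreal (sqrt (p x * q x)) \<partial>N) \<le> 2 * (\<integral>\<^sup>+x. ennreal (sqrt (u x * v x)) \<partial>B)"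
  proof (rule ennreal_le_epsilon)
    fix e :: real assume "0 < e"
    from affinity_near_optimal_weight[OF \<open>finite_measure B\<close> assms(4,5) uv int this]
    obtain \<delta> where \<delta>: "0 < \<delta>" and
      le: "(\<integral>\<^sup>+x. ennreal (sqrt ((v x + \<delta>) / (u x + \<delta>))) \<partial>density B (\<lambda>x. ennreal (u x))) +
      (\<integral>\<^sup>+x. ennreal (1 / sqrt ((v x + \<delta>) / (u x + \<delta>))) \<partial>density B (\<lambda>x. ennreal (v x)))
      \<le> 2 * (\<integral>\<^sup>+x. ennreal (sqrt (u x * v x)) \<partial>B) + ennreal e" .
    define \<psi> where "\<psi> x = sqrt ((v x + \<delta>) / (u x + \<delta>))" for x
    have pos: "0 < \<psi> x" for x using uv[of x] \<delta> by (simp add: \<psi>_def add_nonneg_pos)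
    have [measurable]: "\<psi> \<in> borel_measurable U" unfolding \<psi>_def by measurable
    have "2 * (\<integral>\<^sup>+x. ennreal (sqrt (p x * q x)) \<partial>N) \<le>
       (\<integral>\<^sup>+x. ennreal (\<psi> (T x)) \<partial>density N (\<lambda>x. ennreal (p x))) +
       (\<integral>\<^sup>+x. ennreal (1 / \<psi> (T x)) \<partial>density N (\<lambda>x. ennreal (q x)))"
      by (rule affinity_le_weighted_sum) (use pq pos in auto)
    also have "\<dots> = (\<integral>\<^sup>+x. ennreal (\<psi> x) \<partial>distr (density N (\<lambda>x. ennreal (p x))) U T) +
       (\<integral>\<^sup>+x. ennreal (1 / \<psi> x) \<partial>distr (density N (\<lambda>x. ennreal (q x))) U T)"
      by (subst (1 2) nn_integral_distr) auto
    also have "\<dots> \<le> 2 * (\<integral>\<^sup>+x. ennreal (sqrt (u x * v x)) \<partial>B) + ennreal e"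
      using le by (simp add: dp dq \<psi>_def)
    finally show "2 * (\<integral>\<^sup>+x. ennreal (sqrt (p x * q x)) \<partial>N) \<le>
      2 * (\<integral>\<^sup>+x. ennreal (sqrt (u x * v x)) \<partial>B) + ennreal e" .
  qed
  then show ?thesis
    by (subst (asm) ennreal_mult_le_mult_iff) auto
qed

section \<open>Hellinger distance and partitions\<close>

text \<open>Expanding the square gives D = a + b - 2C, where C is the integral of sqrt(f g) over B,
  and Cauchy-Schwarz gives C <= sqrt(ab). The identity is kept in the additive form D + 2C = a + b
  until all terms are known to be finite, so that no subtraction in \<open>ennreal\<close>
  occurs.\<close>

lemma hellinger_wrt_set_le:
  assumes [measurable]: "f \<in> borel_measurable \<nu>" "g \<in> borel_measurable \<nu>" "B \<in> sets \<nu>"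
    and fg: "\<And>x. 0 \<le> f x" "\<And>x. 0 \<le> g x"
    and a: "emeasure (density \<nu> (\<lambda>x. ennreal (f x))) B = ennreal a" "0 \<le> a"
    and b: "emeasure (density \<nu> (\<lambda>x. ennreal (g x))) B = ennreal b" "0 \<le> b"
  shows "ennreal ((sqrt a - sqrt b)\<^sup>2) \<le>
    (\<integral>\<^sup>+x. ennreal ((sqrt (f x) - sqrt (g x))\<^sup>2) * indicator B x \<partial>\<nu>)"
proof -
  let ?D = "\<integral>\<^sup>+x. ennreal ((sqrt (f x) - sqrt (g x))\<^sup>2) * indicator B x \<partial>\<nu>"
  let ?C = "\<integral>\<^sup>+x. ennreal (sqrt (f x)) * indicator B x * (ennreal (sqrt (g x)) * indicator B x) \<partial>\<nu>"
  have a': "(\<integral>\<^sup>+x. ennreal (f x) * indicator B x \<partial>\<nu>) = ennreal a"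
    using a(1) by (subst (asm) emeasure_density) auto
  have b': "(\<integral>\<^sup>+x. ennreal (g x) * indicator B x \<partial>\<nu>) = ennreal b"
    using b(1) by (subst (asm) emeasure_density) auto
  have sq: "(ennreal (sqrt y) * indicator B x)\<^sup>2 = ennreal y * indicator B x" if "0 \<le> y" for x y
    using that by (auto simp: power_mult_distrib ennreal_power split: split_indicator)
  have "?C\<^sup>2 \<le> (\<integral>\<^sup>+x. (ennreal (sqrt (f x)) * indicator B x)\<^sup>2 \<partial>\<nu>) *
      (\<integral>\<^sup>+x. (ennreal (sqrt (g x)) * indicator B x)\<^sup>2 \<partial>\<nu>)"
    by (rule Cauchy_Schwarz_nn_integral) auto
  also have "\<dots> = ennreal a * ennreal b"
    using fg by (simp only: sq a' b')
  also have "\<dots> = (ennreal (sqrt (a * b)))\<^sup>2"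
    using a b by (simp add: ennreal_mult[symmetric] ennreal_power)
  finally have C2: "?C\<^sup>2 \<le> (ennreal (sqrt (a * b)))\<^sup>2" .
  have C: "?C \<le> ennreal (sqrt (a * b))"
  proof (cases ?C)
    case (real c)
    then have "ennreal (c\<^sup>2) \<le> ennreal ((sqrt (a * b))\<^sup>2)"
      using C2 a b by (simp add: ennreal_power)
    then have "c\<^sup>2 \<le> (sqrt (a * b))\<^sup>2"
      by (subst (asm) ennreal_le_iff) auto
    then have "c \<le> sqrt (a * b)"
      by (rule power2_le_imp_le) (use a b in auto)
    then show ?thesis unfolding real by (rule ennreal_leI)
  next
    case top
    then show ?thesis using C2 a b by (simp add: ennreal_power top_unique)
  qed
  then obtain c where c: "?C = ennreal c" "0 \<le> c"
    by (cases ?C) (auto simp: top_unique)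
  have "?D + 2 * ?C = (\<integral>\<^sup>+x. ennreal ((sqrt (f x) - sqrt (g x))\<^sup>2) * indicator B x +
      2 * (ennreal (sqrt (f x)) * indicator B x * (ennreal (sqrt (g x)) * indicator B x)) \<partial>\<nu>)"
    by (simp add: nn_integral_add nn_integral_cmult)
  also have "\<dots> = (\<integral>\<^sup>+x. ennreal (f x) * indicator B x + ennreal (g x) * indicator B x \<partial>\<nu>)"
  proof (intro nn_integral_cong)
    fix x
    have "(sqrt (f x) - sqrt (g x))\<^sup>2 + 2 * (sqrt (f x) * sqrt (g x)) = f x + g x"
      using fg by (simp add: power2_diff)
    then have "ennreal ((sqrt (f x) - sqrt (g x))\<^sup>2) + 2 * (ennreal (sqrt (f x)) * ennreal (sqrt (g x))) =
        ennreal (f x) + ennreal (g x)"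
      using fg
      by (simp add: ennreal_mult[symmetric] flip: ennreal_plus ennreal_numeral)
    then show "ennreal ((sqrt (f x) - sqrt (g x))\<^sup>2) * indicator B x +
      2 * (ennreal (sqrt (f x)) * indicator B x * (ennreal (sqrt (g x)) * indicator B x)) =
      ennreal (f x) * indicator B x + ennreal (g x) * indicator B x"
      by (auto split: split_indicator)
  qed
  also have "\<dots> = ennreal a + ennreal b"
    by (simp add: nn_integral_add a' b')
  finally have D: "?D + 2 * ?C = ennreal (a + b)" using a b by simp
  then obtain d where d: "?D = ennreal d" "0 \<le> d"
    by (cases ?D) (auto simp: top_unique)
  have "d + 2 * c = a + b"
    using D c d a b by (simp add: ennreal_mult[symmetric] flip: ennreal_plus ennreal_numeral)
  moreover have "c \<le> sqrt (a * b)" using C c a b by simp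
  moreover have "(sqrt a - sqrt b)\<^sup>2 = a + b - 2 * sqrt (a * b)"
    using a b by (simp add: power2_diff real_sqrt_mult)
  ultimately show ?thesis unfolding d by (intro ennreal_leI) linarith
qed

lemma hellinger_wrt_sum_le:
  assumes [measurable]: "f \<in> borel_measurable \<nu>" "g \<in> borel_measurable \<nu>"
    and fg: "\<And>x. 0 \<le> f x" "\<And>x. 0 \<le> g x"
    and "finite I" and B: "\<And>i. i \<in> I \<Longrightarrow> B i \<in> sets \<nu>" and disj: "disjoint_family_on B I"
    and a: "\<And>i. i \<in> I \<Longrightarrow> emeasure (density \<nu> (\<lambda>x. ennreal (f x))) (B i) = ennreal (a i)"
      "\<And>i. i \<in> I \<Longrightarrow> 0 \<le> a i"
    and b: "\<And>i. i \<in> I \<Longrightarrow> emeasure (density \<nu> (\<lambda>x. ennreal (g x))) (B i) = ennreal (b i)"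
      "\<And>i. i \<in> I \<Longrightarrow> 0 \<le> b i"
  shows "ennreal (\<Sum>i\<in>I. (sqrt (a i) - sqrt (b i))\<^sup>2) \<le>
    (\<integral>\<^sup>+x. ennreal ((sqrt (f x) - sqrt (g x))\<^sup>2) \<partial>\<nu>)"
proof -
  let ?D = "\<lambda>x. ennreal ((sqrt (f x) - sqrt (g x))\<^sup>2)"
  have "ennreal (\<Sum>i\<in>I. (sqrt (a i) - sqrt (b i))\<^sup>2) = (\<Sum>i\<in>I. ennreal ((sqrt (a i) - sqrt (b i))\<^sup>2))"
    by simp
  also have "\<dots> \<le> (\<Sum>i\<in>I. \<integral>\<^sup>+x. ?D x * indicator (B i) x \<partial>\<nu>)"
    using assms by (intro sum_mono hellinger_wrt_set_le) auto
  also have "\<dots> = (\<integral>\<^sup>+x. (\<Sum>i\<in>I. ?D x * indicator (B i) x) \<partial>\<nu>)"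
    using B by (intro nn_integral_sum[symmetric]) auto
  also have "\<dots> \<le> (\<integral>\<^sup>+x. ?D x \<partial>\<nu>)"
  proof (intro nn_integral_mono)
    fix x
    have "(\<Sum>i\<in>I. ?D x * indicator (B i) x) = ?D x * indicator (\<Union>i\<in>I. B i) x"
      using disj \<open>finite I\<close> by (simp add: sum_distrib_left[symmetric] indicator_UN_disjoint)
    then show "(\<Sum>i\<in>I. ?D x * indicator (B i) x) \<le> ?D x"
      by (auto split: split_indicator)
  qed
  finally show ?thesis .
qed

text \<open>Subadditivity of the root. This modulus of continuity is the reason why level sets of
  height \<eta>^2, rather than \<eta>, are used below.\<close>

lemma abs_sqrt_diff_le:
  fixes x y :: real assumes "0 \<le> x" "0 \<le> y"
  shows "\<bar>sqrt x - sqrt y\<bar> \<le> sqrt \<bar>x - y\<bar>"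
  using assms
proof (induction x y rule: linorder_wlog)
  case (le x y)
  have "sqrt (x + (y - x)) \<le> sqrt x + sqrt (y - x)"
    using le assms by (intro sqrt_add_le_add_sqrt) auto
  then show ?case using le by simp
qed (simp add: abs_minus_commute)

text \<open>A converse of \<open>hellinger_wrt_set_le\<close> on a set where f is nearly constant.
  The mean \<alpha> = a/v lies in the same interval of length \<eta>^2 as the values of f, so
  replacing f by \<alpha> moves each root by at most \<eta>; for a constant density the integral
  over B is exactly (sqrt a - sqrt b)^2.\<close>

lemma hellinger_wrt_set_ge:
  assumes [measurable]: "f \<in> borel_measurable \<nu>" "B \<in> sets \<nu>"
    and f: "\<And>x. 0 \<le> f x" "\<And>x. f x \<le> 1"
    and v: "emeasure \<nu> B = ennreal v" "0 \<le> v"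
    and a: "emeasure (density \<nu> (\<lambda>x. ennreal (f x))) B = ennreal a" "0 \<le> a"
    and b: "emeasure (density \<nu> (\<lambda>x. ennreal (1 - f x))) B = ennreal b" "0 \<le> b"
    and l: "\<And>x. x \<in> B \<Longrightarrow> l \<le> f x" "\<And>x. x \<in> B \<Longrightarrow> f x \<le> l + \<eta>\<^sup>2" "0 \<le> l" "0 \<le> \<eta>"
  shows "(\<integral>\<^sup>+x. ennreal ((sqrt (f x) - sqrt (1 - f x))\<^sup>2) * indicator B x \<partial>\<nu>) \<le>
    ennreal ((sqrt a - sqrt b)\<^sup>2 + 4 * \<eta> * v)"
\<comment> \<open>On a null set there is no mean value a/v, but the integral vanishes.\<close>
proof (cases "v = 0")
  case True
  then have "AE x in \<nu>. x \<notin> B"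
    using v by (intro AE_not_in) (auto simp: null_sets_def)
  then have "(\<integral>\<^sup>+x. ennreal ((sqrt (f x) - sqrt (1 - f x))\<^sup>2) * indicator B x \<partial>\<nu>) = 0"
    by (subst nn_integral_0_iff_AE) auto
  then show ?thesis by simp
next
  case False
  then have "0 < v" using v by simp
  have a': "(\<integral>\<^sup>+x. ennreal (f x) * indicator B x \<partial>\<nu>) = ennreal a"
    using a(1) by (subst (asm) emeasure_density) auto
  have b': "(\<integral>\<^sup>+x. ennreal (1 - f x) * indicator B x \<partial>\<nu>) = ennreal b"
    using b(1) by (subst (asm) emeasure_density) auto
  have "ennreal a + ennreal b = (\<integral>\<^sup>+x. ennreal (f x) * indicator B x + ennreal (1 - f x) * indicator B x \<partial>\<nu>)"
    by (simp add: nn_integral_add a' b')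
  also have "\<dots> = (\<integral>\<^sup>+x. indicator B x \<partial>\<nu>)"
    using f by (intro nn_integral_cong) (auto split: split_indicator simp flip: ennreal_plus)
  finally have ab: "a + b = v" using a b v by (simp flip: ennreal_plus)
  have "ennreal (l * v) = (\<integral>\<^sup>+x. ennreal l * indicator B x \<partial>\<nu>)"
    using l v by (subst nn_integral_cmult_indicator) (auto simp: ennreal_mult)
  also have "\<dots> \<le> (\<integral>\<^sup>+x. ennreal (f x) * indicator B x \<partial>\<nu>)"
    using l by (intro nn_integral_mono) (auto split: split_indicator intro: ennreal_leI)
  also have "\<dots> = ennreal a" by (rule a')
  finally have "l * v \<le> a" using a by simp
  have "ennreal a = (\<integral>\<^sup>+x. ennreal (f x) * indicator B x \<partial>\<nu>)"
    by (rule a'[symmetric])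
  also have "\<dots> \<le> (\<integral>\<^sup>+x. ennreal (l + \<eta>\<^sup>2) * indicator B x \<partial>\<nu>)"
    using l by (intro nn_integral_mono) (auto split: split_indicator intro!: ennreal_leI simp del: ennreal_plus)
  also have "\<dots> = ennreal ((l + \<eta>\<^sup>2) * v)"
    using l v by (subst nn_integral_cmult_indicator) (auto simp: ennreal_mult)
  finally have "a \<le> (l + \<eta>\<^sup>2) * v" using l v by (simp add: ennreal_le_iff)
  define \<alpha> where "\<alpha> = a / v"
  have \<alpha>: "l \<le> \<alpha>" "\<alpha> \<le> l + \<eta>\<^sup>2" "0 \<le> \<alpha>" "\<alpha> \<le> 1"
    using \<open>0 < v\<close> \<open>l * v \<le> a\<close> \<open>a \<le> (l + \<eta>\<^sup>2) * v\<close> a b ab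
    by (auto simp: \<alpha>_def pos_le_divide_eq pos_divide_le_eq)
  have av: "a = v * \<alpha>" "b = v * (1 - \<alpha>)"
    using \<open>0 < v\<close> ab by (auto simp: \<alpha>_def field_simps)
  have w: "v * (sqrt \<alpha> - sqrt (1 - \<alpha>))\<^sup>2 = (sqrt a - sqrt b)\<^sup>2"
  proof -
    have "sqrt a - sqrt b = sqrt v * (sqrt \<alpha> - sqrt (1 - \<alpha>))"
      unfolding av real_sqrt_mult by (simp add: algebra_simps)
    then show ?thesis using v by (simp add: power_mult_distrib)
  qed
  have pt: "(sqrt (f x) - sqrt (1 - f x))\<^sup>2 \<le> (sqrt \<alpha> - sqrt (1 - \<alpha>))\<^sup>2 + 4 * \<eta>" if "x \<in> B" for x
  proof -
    have d: "\<bar>f x - \<alpha>\<bar> \<le> \<eta>\<^sup>2" using l(1,2)[OF that] \<alpha> by auto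
    have "\<bar>sqrt (f x) - sqrt \<alpha>\<bar> \<le> sqrt \<bar>f x - \<alpha>\<bar>"
      using f \<alpha> by (intro abs_sqrt_diff_le) auto
    also have "\<dots> \<le> \<eta>" using d l by (intro real_le_lsqrt) auto
    finally have 1: "\<bar>sqrt (f x) - sqrt \<alpha>\<bar> \<le> \<eta>" .
    have "\<bar>sqrt (1 - f x) - sqrt (1 - \<alpha>)\<bar> \<le> sqrt \<bar>(1 - f x) - (1 - \<alpha>)\<bar>"
      using f \<alpha> by (intro abs_sqrt_diff_le) auto
    also have "\<dots> \<le> \<eta>" using d l by (intro real_le_lsqrt) auto
    finally have 2: "\<bar>sqrt (1 - f x) - sqrt (1 - \<alpha>)\<bar> \<le> \<eta>" .
    define u w where "u = sqrt (f x) - sqrt (1 - f x)" and "w = sqrt \<alpha> - sqrt (1 - \<alpha>)"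
    have r: "0 \<le> sqrt (f x)" "sqrt (f x) \<le> 1" "0 \<le> sqrt (1 - f x)" "sqrt (1 - f x) \<le> 1"
      "0 \<le> sqrt \<alpha>" "sqrt \<alpha> \<le> 1" "0 \<le> sqrt (1 - \<alpha>)" "sqrt (1 - \<alpha>) \<le> 1"
      using f[of x] \<alpha> by auto
    \<comment> \<open>The constant 4 comes from u^2 - w^2 = (u - w)(u + w): two roots move by \<eta>
      each, and u and w both lie in [-1,1].\<close>
    have "\<bar>u - w\<bar> \<le> 2 * \<eta>" "\<bar>u + w\<bar> \<le> 2" unfolding u_def w_def using 1 2 r by linarith+
    then have "\<bar>u - w\<bar> * \<bar>u + w\<bar> \<le> (2 * \<eta>) * 2"
      using l by (intro mult_mono) auto
    then have "(u - w) * (u + w) \<le> 4 * \<eta>" by (simp add: abs_mult[symmetric])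
    then show ?thesis by (simp add: u_def[symmetric] w_def[symmetric] power2_eq_square algebra_simps)
  qed
  have "(\<integral>\<^sup>+x. ennreal ((sqrt (f x) - sqrt (1 - f x))\<^sup>2) * indicator B x \<partial>\<nu>) \<le>
      (\<integral>\<^sup>+x. ennreal ((sqrt \<alpha> - sqrt (1 - \<alpha>))\<^sup>2 + 4 * \<eta>) * indicator B x \<partial>\<nu>)"
    using pt by (intro nn_integral_mono) (auto split: split_indicator intro: ennreal_leI)
  also have "\<dots> = ennreal (((sqrt \<alpha> - sqrt (1 - \<alpha>))\<^sup>2 + 4 * \<eta>) * v)"
    using l v by (subst nn_integral_cmult_indicator) (auto simp: ennreal_mult)
  also have "((sqrt \<alpha> - sqrt (1 - \<alpha>))\<^sup>2 + 4 * \<eta>) * v = (sqrt a - sqrt b)\<^sup>2 + 4 * \<eta> * v"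
    using w by (simp add: algebra_simps)
  finally show ?thesis .
qed

text \<open>Monotone convergence first restricts the integral to a set \<open>S k\<close> of finite
  measure without falling to r. Cutting this set along level sets of f costs at most 4\<eta> times
  its measure, which the strict inequality in the hypothesis can absorb. The integral itself may be
  infinite.\<close>

lemma hellinger_wrt_partition:
  assumes "sigma_finite_measure \<nu>"
    and [measurable]: "f \<in> borel_measurable \<nu>"
    and f: "\<And>x. 0 \<le> f x" "\<And>x. f x \<le> 1"
    and r: "ennreal r < (\<integral>\<^sup>+x. ennreal ((sqrt (f x) - sqrt (1 - f x))\<^sup>2) \<partial>\<nu>)" "0 \<le> r"
  obtains n :: nat and B :: "nat \<Rightarrow> 'a set" where "0 < n" "\<And>i. B i \<in> sets \<nu>" "disjoint_family B"
    "\<And>i. emeasure \<nu> (B i) \<noteq> \<infinity>"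
    "r \<le> (\<Sum>i<n. (sqrt (measure (density \<nu> (\<lambda>x. ennreal (f x))) (B i)) -
       sqrt (measure (density \<nu> (\<lambda>x. ennreal (1 - f x))) (B i)))\<^sup>2)"
proof -
  interpret sigma_finite_measure \<nu> by fact
  let ?D = "\<lambda>x. ennreal ((sqrt (f x) - sqrt (1 - f x))\<^sup>2)"
  obtain S :: "nat \<Rightarrow> 'a set" where S: "range S \<subseteq> sets \<nu>" "(\<Union>i. S i) = space \<nu>"
    "\<And>i. emeasure \<nu> (S i) \<noteq> \<infinity>" "incseq S"
    using sigma_finite_incseq by blast
  have [measurable]: "S i \<in> sets \<nu>" for i using S by auto
  have SUP: "(SUP k. \<integral>\<^sup>+x. ?D x * indicator (S k) x \<partial>\<nu>) = (\<integral>\<^sup>+x. ?D x \<partial>\<nu>)"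
  proof -
    have "(SUP k. \<integral>\<^sup>+x. ?D x * indicator (S k) x \<partial>\<nu>) = (\<integral>\<^sup>+x. (SUP k. ?D x * indicator (S k) x) \<partial>\<nu>)"
      using incseq_SucD[OF S(4)]
      by (intro nn_integral_monotone_convergence_SUP[symmetric] incseq_SucI le_funI mult_left_mono)
        (auto simp: indicator_def subset_iff)
    also have "\<dots> = (\<integral>\<^sup>+x. ?D x \<partial>\<nu>)"
    proof (intro nn_integral_cong antisym)
      fix x assume "x \<in> space \<nu>"
      then obtain k where "x \<in> S k" using S(2) by blast
      then show "?D x \<le> (SUP k. ?D x * indicator (S k) x)"
        by (intro SUP_upper2[of k]) auto
    qed (auto intro!: SUP_least split: split_indicator)
    finally show ?thesis .
  qed
  obtain k where k: "ennreal r < (\<integral>\<^sup>+x. ?D x * indicator (S k) x \<partial>\<nu>)"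
    using r(1) unfolding SUP[symmetric] less_SUP_iff by auto
  obtain V where V: "emeasure \<nu> (S k) = ennreal V" "0 \<le> V"
    using S(3)[of k] by (cases "emeasure \<nu> (S k)") auto
  obtain r' where r': "r < r'" "ennreal r' \<le> (\<integral>\<^sup>+x. ?D x * indicator (S k) x \<partial>\<nu>)"
  proof (cases "\<integral>\<^sup>+x. ?D x * indicator (S k) x \<partial>\<nu>")
    case top
    then show ?thesis using that[of "r + 1"] by simp
  next
    case (real z)
    then show ?thesis using that[of z] k r by (simp add: ennreal_less_iff)
  qed
  \<comment> \<open>Chosen so that the total cutting error 4\<eta>V is at most the slack r' - r; the
    summand 1 covers V = 0.\<close>
  define \<eta> where "\<eta> = (r' - r) / (4 * V + 1)"
  have \<eta>: "0 < \<eta>" using r' V by (auto simp: \<eta>_def)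
  have \<eta>': "4 * \<eta> * V \<le> r' - r"
    using r' V by (simp add: \<eta>_def field_simps)
  obtain m :: nat where m: "1 / \<eta>\<^sup>2 < real m" using reals_Archimedean2 by blast
  have "0 < 1 / \<eta>\<^sup>2" using \<eta> by simp
  then have "0 < real m" using m by linarith
  then have m0: "0 < m" "1 / real m \<le> \<eta>\<^sup>2" using m \<eta> by (auto simp: field_simps)
  define B where "B i = {x \<in> space \<nu>. x \<in> S k \<and> nat \<lfloor>real m * f x\<rfloor> = i}" for i
  have Bm[measurable]: "B i \<in> sets \<nu>" for i unfolding B_def by measurable
  have disj: "disjoint_family B" by (auto simp: disjoint_family_on_def B_def)
  \<comment> \<open>There are m + 1 slices: f ranges over the closed interval [0,1], and the value 1
    falls into slice m.\<close>
  have UB: "(\<Union>i<Suc m. B i) = S k"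
  proof -
    have "nat \<lfloor>real m * f x\<rfloor> < Suc m" for x
    proof -
      have "real m * f x \<le> real m" using f[of x] by (simp add: mult_left_le)
      then have "\<lfloor>real m * f x\<rfloor> \<le> int m" by linarith
      then show ?thesis by linarith
    qed
    then show ?thesis using sets.sets_into_space[of "S k" \<nu>] by (auto simp: B_def)
  qed
  have "emeasure \<nu> (B i) \<le> emeasure \<nu> (S k)" for i
    by (rule emeasure_mono) (auto simp: B_def)
  then have Bfin: "emeasure \<nu> (B i) \<noteq> \<infinity>" for i
    using S(3)[of k] by (metis infinity_ennreal_def top_unique)
  let ?L = "density \<nu> (\<lambda>x. ennreal (f x))" and ?M = "density \<nu> (\<lambda>x. ennreal (1 - f x))"
  have fin: "emeasure (density \<nu> (\<lambda>x. ennreal (h x))) (B i) = ennreal (measure (density \<nu> (\<lambda>x. ennreal (h x))) (B i))"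
    if [measurable]: "h \<in> borel_measurable \<nu>" and "\<And>x. h x \<le> 1" for h :: "'a \<Rightarrow> real" and i
  proof -
    have "emeasure (density \<nu> (\<lambda>x. ennreal (h x))) (B i) = (\<integral>\<^sup>+x. ennreal (h x) * indicator (B i) x \<partial>\<nu>)"
      by (subst emeasure_density) auto
    also have "\<dots> \<le> (\<integral>\<^sup>+x. 1 * indicator (B i) x \<partial>\<nu>)"
      using that(2) by (intro nn_integral_mono mult_right_mono) (auto simp: ennreal_le_1)
    also have "\<dots> = emeasure \<nu> (B i)" by simp
    finally have "emeasure (density \<nu> (\<lambda>x. ennreal (h x))) (B i) \<le> emeasure \<nu> (B i)" .
    then show ?thesis
      using Bfin[of i] by (intro emeasure_eq_ennreal_measure) (auto simp: top_unique)
  qed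
  have finL: "emeasure ?L (B i) = ennreal (measure ?L (B i))"
    and finM: "emeasure ?M (B i) = ennreal (measure ?M (B i))"
    and finN: "emeasure \<nu> (B i) = ennreal (measure \<nu> (B i))" for i
    using f Bfin[of i] by (auto intro!: fin intro: emeasure_eq_ennreal_measure)
  let ?s = "\<lambda>i. (sqrt (measure ?L (B i)) - sqrt (measure ?M (B i)))\<^sup>2"
  have "ennreal r' \<le> (\<integral>\<^sup>+x. ?D x * indicator (S k) x \<partial>\<nu>)" by (rule r')
  also have "\<dots> = (\<integral>\<^sup>+x. (\<Sum>i<Suc m. ?D x * indicator (B i) x) \<partial>\<nu>)"
  proof (intro nn_integral_cong)
    fix x
    have "disjoint_family_on B {..<Suc m}" using disj by (auto simp: disjoint_family_on_def)
    then show "?D x * indicator (S k) x = (\<Sum>i<Suc m. ?D x * indicator (B i) x)"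
      by (simp add: UB[symmetric] sum_distrib_left[symmetric] indicator_UN_disjoint del: sum.lessThan_Suc)
  qed
  also have "\<dots> = (\<Sum>i<Suc m. \<integral>\<^sup>+x. ?D x * indicator (B i) x \<partial>\<nu>)"
    by (intro nn_integral_sum) auto
  also have "\<dots> \<le> (\<Sum>i<Suc m. ennreal (?s i + 4 * \<eta> * measure \<nu> (B i)))"
  proof (intro sum_mono hellinger_wrt_set_ge[where l = "_ / real m"])
    fix i x assume "x \<in> B i"
    then have i: "real i \<le> real m * f x" "real m * f x \<le> real i + 1"
      using f(1)[of x] by (auto simp: B_def)
    then show "real i / real m \<le> f x" using m0 by (simp add: field_simps)
    have "f x \<le> real i / real m + 1 / real m" using i m0 by (simp add: field_simps)
    then show "f x \<le> real i / real m + \<eta>\<^sup>2" using m0 by linarith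
  qed (use f \<eta> finL finM finN in auto)
  also have "\<dots> = ennreal ((\<Sum>i<Suc m. ?s i) + 4 * \<eta> * (\<Sum>i<Suc m. measure \<nu> (B i)))"
    using \<eta> by (subst sum_ennreal) (auto simp: sum.distrib sum_distrib_left simp del: sum.lessThan_Suc)
  also have "(\<Sum>i<Suc m. measure \<nu> (B i)) = measure \<nu> (\<Union>i<Suc m. B i)"
    using disj Bfin by (intro measure_finite_Union[symmetric]) (auto simp: disjoint_family_on_def)
  also have "\<dots> = V" unfolding UB using V by (simp add: measure_def)
  finally have "r' \<le> (\<Sum>i<Suc m. ?s i) + 4 * \<eta> * V"
    using V \<eta> by (subst (asm) ennreal_le_iff) (auto intro!: add_nonneg_nonneg sum_nonneg simp del: sum.lessThan_Suc)
  then have "r \<le> (\<Sum>i<Suc m. ?s i)" using \<eta>' by linarith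
  then show ?thesis by (intro that[of "Suc m" B]) (use disj Bfin in auto)
qed

section \<open>Counts of disjoint sets\<close>

text \<open>Both sides agree on boxes by Fubini for products. Sigma-finiteness of the factors
  \<open>M i\<close> serves Fubini; that of the factors with density serves the uniqueness of the
  product measure.\<close>

lemma PiM_density:
  assumes "finite I" "product_sigma_finite M" "product_sigma_finite (\<lambda>i. density (M i) (f i))"
    and f [measurable]: "\<And>i. i \<in> I \<Longrightarrow> f i \<in> borel_measurable (M i)"
  shows "Pi\<^sub>M I (\<lambda>i. density (M i) (f i)) = density (Pi\<^sub>M I M) (\<lambda>x. \<Prod>i\<in>I. f i (x i))"
proof -
  interpret M: product_sigma_finite M by fact
  interpret D: product_sigma_finite "\<lambda>i. density (M i) (f i)" by fact
  have sets: "sets (Pi\<^sub>M I (\<lambda>i. density (M i) (f i))) = sets (Pi\<^sub>M I M)"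
    by (rule sets_PiM_cong) auto
  have meas: "(\<lambda>x. \<Prod>i\<in>I. f i (x i)) \<in> borel_measurable (Pi\<^sub>M I M)"
    by measurable
  show ?thesis
  proof (rule D.PiM_eqI[symmetric])
    fix A assume A: "\<And>i. i \<in> I \<Longrightarrow> A i \<in> sets (density (M i) (f i))"
    have PA: "Pi\<^sub>E I A \<in> sets (Pi\<^sub>M I M)" using A \<open>finite I\<close> by (intro sets_PiM_I_finite) auto
    have "emeasure (density (Pi\<^sub>M I M) (\<lambda>x. \<Prod>i\<in>I. f i (x i))) (Pi\<^sub>E I A) =
       (\<integral>\<^sup>+x. (\<Prod>i\<in>I. f i (x i)) * indicator (Pi\<^sub>E I A) x \<partial>Pi\<^sub>M I M)"
      by (rule emeasure_density[OF meas PA])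
    also have "\<dots> = (\<integral>\<^sup>+x. (\<Prod>i\<in>I. f i (x i) * indicator (A i) (x i)) \<partial>Pi\<^sub>M I M)"
    proof (intro nn_integral_cong)
      fix x assume "x \<in> space (Pi\<^sub>M I M)"
      then have "x \<in> extensional I" by (auto simp: space_PiM PiE_def)
      then have "indicator (Pi\<^sub>E I A) x = (\<Prod>i\<in>I. indicator (A i) (x i) :: ennreal)"
        using \<open>finite I\<close> by (auto simp: indicator_def PiE_iff prod_zero_iff)
      then show "(\<Prod>i\<in>I. f i (x i)) * indicator (Pi\<^sub>E I A) x = (\<Prod>i\<in>I. f i (x i) * indicator (A i) (x i))"
        by (simp add: prod.distrib)
    qed
    also have "\<dots> = (\<Prod>i\<in>I. \<integral>\<^sup>+y. f i y * indicator (A i) y \<partial>M i)"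
      using \<open>finite I\<close> A by (intro M.product_nn_integral_prod) auto
    also have "\<dots> = (\<Prod>i\<in>I. emeasure (density (M i) (f i)) (A i))"
      using A f by (intro prod.cong refl emeasure_density[symmetric]) auto
    finally show "emeasure (density (Pi\<^sub>M I M) (\<lambda>x. \<Prod>i\<in>I. f i (x i))) (Pi\<^sub>E I A) =
       (\<Prod>i\<in>I. emeasure (density (M i) (f i)) (A i))" .
  qed (use \<open>finite I\<close> sets in auto)
qed

section \<open>Measurability and joint law of counts\<close>

lemma space_point_pattern_space: "space (point_pattern_space S) = point_patterns S"
  unfolding point_pattern_space_def by (rule space_measure_of) auto

lemma sets_point_pattern_space:
  "sets (point_pattern_space S) = sigma_sets (point_patterns S)
     {(\<lambda>\<eta>. emeasure \<eta> B) -` A \<inter> point_patterns S | B A. B \<in> sets S \<and> A \<in> sets borel}"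
  unfolding point_pattern_space_def by (rule sets_measure_of) auto

lemma sets_point_pattern: "\<eta> \<in> point_patterns S \<Longrightarrow> sets \<eta> = sets S"
  by (simp add: point_patterns_def)

lemma measurable_count:
  assumes "sets P = sets (point_pattern_space S)" "B \<in> sets S"
  shows "(\<lambda>\<eta>. emeasure \<eta> B) \<in> borel_measurable P"
proof (rule measurableI)
  fix A :: "ennreal set" assume "A \<in> sets borel"
  then show "(\<lambda>\<eta>. emeasure \<eta> B) -` A \<inter> space P \<in> sets P"
    using assms sets_eq_imp_space_eq[OF assms(1)]
    by (auto simp: space_point_pattern_space sets_point_pattern_space)
qed simp

abbreviation poisson_base_PiM :: "nat \<Rightarrow> (nat \<Rightarrow> ennreal) measure" where
  "poisson_base_PiM n \<equiv> Pi\<^sub>M {..<n} (\<lambda>_. poisson_base)"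

definition poisson_dens_PiM :: "nat \<Rightarrow> (nat \<Rightarrow> real) \<Rightarrow> (nat \<Rightarrow> ennreal) \<Rightarrow> real" where
  "poisson_dens_PiM n a x = (\<Prod>i<n. poisson_dens (a i) (x i))"

definition counts :: "nat \<Rightarrow> (nat \<Rightarrow> 'a set) \<Rightarrow> 'a measure \<Rightarrow> nat \<Rightarrow> ennreal" where
  "counts n B \<eta> = (\<lambda>i\<in>{..<n}. emeasure \<eta> (B i))"

lemma sets_poisson_base_PiM [measurable_cong]:
  "sets (poisson_base_PiM n) = sets (Pi\<^sub>M {..<n} (\<lambda>_. borel))"
  by (rule sets_PiM_cong) auto

lemma prob_space_poisson_base_PiM: "prob_space (poisson_base_PiM n)"
  by (rule prob_space_PiM) (rule prob_space_poisson_base)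

lemma product_sigma_finite_poisson_base: "product_sigma_finite (\<lambda>_. poisson_base)"
  by (intro product_sigma_finite.intro prob_space_imp_sigma_finite prob_space_poisson_base)

lemma poisson_dens_PiM_measurable [measurable]:
  "poisson_dens_PiM n a \<in> borel_measurable (poisson_base_PiM n)"
  unfolding poisson_dens_PiM_def by measurable

lemma poisson_dens_PiM_nonneg:
  "(\<And>i. i < n \<Longrightarrow> 0 \<le> a i) \<Longrightarrow> 0 \<le> poisson_dens_PiM n a x"
  unfolding poisson_dens_PiM_def by (intro prod_nonneg) (auto intro: poisson_dens_nonneg)

lemma measurable_counts:
  assumes "sets P = sets (point_pattern_space S)" "\<And>i. i < n \<Longrightarrow> B i \<in> sets S"
  shows "counts n B \<in> P \<rightarrow>\<^sub>M Pi\<^sub>M {..<n} (\<lambda>_. borel)"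
  unfolding counts_def using assms by (intro measurable_restrict measurable_count[of _ S]) auto

text \<open>Independence makes the joint law a product, and each factor has a density with respect
  to \<open>poisson_base\<close> because its mean is finite. For mean \<infinity> the factor would
  be a point mass at \<infinity>, which \<open>poisson_base\<close> does not charge.\<close>

lemma distr_counts:
  assumes P: "poisson_PP S \<Lambda> P" and n: "0 < n"
    and B: "\<And>i. i < n \<Longrightarrow> B i \<in> sets S" and disj: "disjoint_family_on B {..<n}"
    and a: "\<And>i. i < n \<Longrightarrow> emeasure \<Lambda> (B i) = ennreal (a i)" "\<And>i. i < n \<Longrightarrow> 0 \<le> a i"
  shows "distr P (Pi\<^sub>M {..<n} (\<lambda>_. borel)) (counts n B) =
    density (poisson_base_PiM n) (\<lambda>x. ennreal (poisson_dens_PiM n a x))"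
proof -
  interpret prob_space P using P by (simp add: poisson_PP_def)
  have sP: "sets P = sets (point_pattern_space S)" using P by (simp add: poisson_PP_def)
  \<comment> \<open>\<open>product_sigma_finite\<close> speaks about every index, also those from n
    on, where nothing is known about \<open>a\<close>. The default 0 makes every factor a
    probability measure.\<close>
  define a' where "a' i = (if i < n then a i else 0)" for i
  have a': "0 \<le> a' i" for i using a by (simp add: a'_def)
  have ps: "prob_space (density poisson_base (\<lambda>y. ennreal (poisson_dens (a' i) y)))" for i
    unfolding poisson_ennreal_eq_density[OF a', symmetric]
    by (auto simp: poisson_ennreal_def prob_space_return
       intro!: prob_space.prob_space_distr measure_pmf.prob_space_axioms)
  have "indep_vars (\<lambda>_. borel) (\<lambda>i \<eta>. emeasure \<eta> (B i)) {..<n}"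
    using P n B disj by (simp add: poisson_PP_def)
  then have "distr P (Pi\<^sub>M {..<n} (\<lambda>_. borel)) (counts n B) =
      Pi\<^sub>M {..<n} (\<lambda>i. distr P borel (\<lambda>\<eta>. emeasure \<eta> (B i)))"
    unfolding counts_def
    using n B by (subst (asm) indep_vars_iff_distr_eq_PiM') (auto intro: measurable_count[OF sP])
  also have "\<dots> = Pi\<^sub>M {..<n} (\<lambda>i. density poisson_base (\<lambda>y. ennreal (poisson_dens (a' i) y)))"
  proof (intro PiM_cong refl)
    fix i assume "i \<in> {..<n}"
    then have "B i \<in> sets S" "emeasure \<Lambda> (B i) = ennreal (a' i)"
      using a B by (auto simp: a'_def)
    then show "distr P borel (\<lambda>\<eta>. emeasure \<eta> (B i)) =
        density poisson_base (\<lambda>y. ennreal (poisson_dens (a' i) y))"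
      using P a' by (simp add: poisson_PP_def poisson_ennreal_eq_density[symmetric])
  qed
  also have "\<dots> = density (poisson_base_PiM n) (\<lambda>x. \<Prod>i<n. ennreal (poisson_dens (a' i) (x i)))"
    by (intro PiM_density product_sigma_finite_poisson_base product_sigma_finite.intro
        prob_space_imp_sigma_finite ps) auto
  also have "\<dots> = density (poisson_base_PiM n) (\<lambda>x. ennreal (poisson_dens_PiM n a x))"
  proof -
    have "(\<Prod>i<n. ennreal (poisson_dens (a' i) (x i))) = ennreal (poisson_dens_PiM n a x)" for x
      using a' by (simp add: poisson_dens_PiM_def prod_ennreal poisson_dens_nonneg) (simp add: a'_def)
    then show ?thesis by simp
  qed
  finally show ?thesis .
qed

lemma sqrt_prod: "sqrt (\<Prod>i\<in>I. f i) = (\<Prod>i\<in>I. sqrt (f i))"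
proof (cases "finite I")
  case True
  then show ?thesis
  proof induction
    case (insert x F)
    have "sqrt (\<Prod>i\<in>insert x F. f i) = sqrt (f x * (\<Prod>i\<in>F. f i))"
      using insert.hyps by (subst prod.insert) auto
    also have "\<dots> = sqrt (f x) * (\<Prod>i\<in>F. sqrt (f i))"
      by (subst real_sqrt_mult) (subst insert.IH, rule refl)
    also have "\<dots> = (\<Prod>i\<in>insert x F. sqrt (f i))"
      using insert.hyps by (subst prod.insert) auto
    finally show ?case .
  qed auto
qed simp

lemma nn_integral_sqrt_poisson_dens_PiM:
  assumes a: "\<And>i. i < n \<Longrightarrow> 0 \<le> a i" and b: "\<And>i. i < n \<Longrightarrow> 0 \<le> b i"
  shows "(\<integral>\<^sup>+x. ennreal (sqrt (poisson_dens_PiM n a x * poisson_dens_PiM n b x)) \<partial>poisson_base_PiM n) =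
    ennreal (exp (- ((\<Sum>i<n. (sqrt (a i) - sqrt (b i))\<^sup>2) / 2)))"
proof -
  interpret product_sigma_finite "\<lambda>_::nat. poisson_base" by (rule product_sigma_finite_poisson_base)
  let ?g = "\<lambda>i y. ennreal (sqrt (poisson_dens (a i) y * poisson_dens (b i) y))"
  have "(\<integral>\<^sup>+x. ennreal (sqrt (poisson_dens_PiM n a x * poisson_dens_PiM n b x)) \<partial>poisson_base_PiM n) =
      (\<integral>\<^sup>+x. (\<Prod>i<n. ?g i (x i)) \<partial>poisson_base_PiM n)"
  proof (intro nn_integral_cong)
    fix x
    have "(\<Prod>i<n. ?g i (x i)) = ennreal (\<Prod>i<n. sqrt (poisson_dens (a i) (x i) * poisson_dens (b i) (x i)))"
      using a b by (intro prod_ennreal) (auto intro!: mult_nonneg_nonneg poisson_dens_nonneg)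
    then show "ennreal (sqrt (poisson_dens_PiM n a x * poisson_dens_PiM n b x)) = (\<Prod>i<n. ?g i (x i))"
      by (simp only: poisson_dens_PiM_def prod.distrib[symmetric] sqrt_prod)
  qed
  also have "\<dots> = (\<Prod>i<n. \<integral>\<^sup>+y. ?g i y \<partial>poisson_base)"
    by (intro product_nn_integral_prod) auto
  also have "\<dots> = (\<Prod>i<n. ennreal (exp (- ((sqrt (a i) - sqrt (b i))\<^sup>2 / 2))))"
    using a b by (intro prod.cong refl nn_integral_sqrt_poisson_dens) auto
  also have "\<dots> = ennreal (exp (- ((\<Sum>i<n. (sqrt (a i) - sqrt (b i))\<^sup>2) / 2)))"
    by (subst prod_ennreal) (simp_all only: exp_sum[symmetric] sum_negf sum_divide_distrib exp_ge_zero finite_lessThan)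
  finally show ?thesis .
qed

section \<open>Approximation by functions of finitely many counts\<close>

text \<open>The counted sets index their own coordinates, so two such functions are combined over
  \<open>I \<union> J\<close> without renumbering. The sets may overlap here; disjointness is
  arranged in \<open>cylinder_fun_counts\<close>. Finite \<nu>-measure will mean finite intensity
  under both processes.\<close>

definition cylinder_fun :: "'a measure \<Rightarrow> 'a measure \<Rightarrow> ('a measure \<Rightarrow> real) \<Rightarrow> bool" where
  "cylinder_fun S \<nu> v \<longleftrightarrow> (\<exists>I g. finite I \<and> I \<subseteq> fmeasurable \<nu> \<and>
     g \<in> borel_measurable (Pi\<^sub>M I (\<lambda>_. borel)) \<and>
     (\<forall>\<eta>\<in>point_patterns S. v \<eta> = g (restrict (emeasure \<eta>) I)))"

lemma cylinder_fun_const: "cylinder_fun S \<nu> (\<lambda>_. c)"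
  unfolding cylinder_fun_def by (intro exI[of _ "{}"] exI[of _ "\<lambda>_. c"]) auto

lemma cylinder_fun_count:
  assumes "B \<in> fmeasurable \<nu>" and [measurable]: "f \<in> borel_measurable borel"
  shows "cylinder_fun S \<nu> (\<lambda>\<eta>. f (emeasure \<eta> B))"
  unfolding cylinder_fun_def
  using assms by (intro exI[of _ "{B}"] exI[of _ "\<lambda>x. f (x B)"]) auto

lemma cylinder_fun_cong:
  "(\<And>\<eta>. \<eta> \<in> point_patterns S \<Longrightarrow> v \<eta> = w \<eta>) \<Longrightarrow> cylinder_fun S \<nu> v \<longleftrightarrow> cylinder_fun S \<nu> w"
  by (simp add: cylinder_fun_def)

lemma cylinder_fun_binop:
  assumes v: "cylinder_fun S \<nu> v" and w: "cylinder_fun S \<nu> w"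
    and h [measurable]: "(\<lambda>(x, y). h x y) \<in> borel_measurable (borel \<Otimes>\<^sub>M borel)"
  shows "cylinder_fun S \<nu> (\<lambda>\<eta>. h (v \<eta>) (w \<eta>))"
proof -
  obtain I f where I: "finite I" "I \<subseteq> fmeasurable \<nu>" and f [measurable]: "f \<in> borel_measurable (Pi\<^sub>M I (\<lambda>_. borel))"
    and v: "\<forall>\<eta>\<in>point_patterns S. v \<eta> = f (restrict (emeasure \<eta>) I)"
    using v unfolding cylinder_fun_def by blast
  obtain J g where J: "finite J" "J \<subseteq> fmeasurable \<nu>" and g [measurable]: "g \<in> borel_measurable (Pi\<^sub>M J (\<lambda>_. borel))"
    and w: "\<forall>\<eta>\<in>point_patterns S. w \<eta> = g (restrict (emeasure \<eta>) J)"
    using w unfolding cylinder_fun_def by blast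
  have "(\<lambda>x. (f (restrict x I), g (restrict x J))) \<in> Pi\<^sub>M (I \<union> J) (\<lambda>_. borel) \<rightarrow>\<^sub>M borel \<Otimes>\<^sub>M borel"
    by (intro measurable_Pair measurable_compose[OF measurable_restrict_subset f]
        measurable_compose[OF measurable_restrict_subset g]) auto
  from measurable_compose[OF this h]
  have "(\<lambda>x. h (f (restrict x I)) (g (restrict x J))) \<in> borel_measurable (Pi\<^sub>M (I \<union> J) (\<lambda>_. borel))"
    by simp
  moreover have "h (v \<eta>) (w \<eta>) = h (f (restrict (restrict (emeasure \<eta>) (I \<union> J)) I))
      (g (restrict (restrict (emeasure \<eta>) (I \<union> J)) J))" if "\<eta> \<in> point_patterns S" for \<eta>
  proof -
    have "restrict (restrict (emeasure \<eta>) (I \<union> J)) I = restrict (emeasure \<eta>) I"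
      "restrict (restrict (emeasure \<eta>) (I \<union> J)) J = restrict (emeasure \<eta>) J"
      by (auto simp: restrict_def)
    then show ?thesis using v w that by simp
  qed
  ultimately show ?thesis
    unfolding cylinder_fun_def using I J
    by (intro exI[of _ "I \<union> J"] exI[of _ "\<lambda>x. h (f (restrict x I)) (g (restrict x J))"]) auto
qed

lemma cylinder_fun_measurable:
  assumes v: "cylinder_fun S \<nu> v" and sets: "sets \<nu> = sets S" "sets R = sets (point_pattern_space S)"
  shows "v \<in> borel_measurable R"
proof -
  have sp: "space R = point_patterns S"
    using sets_eq_imp_space_eq[OF sets(2)] by (simp add: space_point_pattern_space)
  obtain I f where I: "finite I" "I \<subseteq> fmeasurable \<nu>" and f [measurable]: "f \<in> borel_measurable (Pi\<^sub>M I (\<lambda>_. borel))"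
    and v: "\<forall>\<eta>\<in>point_patterns S. v \<eta> = f (restrict (emeasure \<eta>) I)"
    using v unfolding cylinder_fun_def by blast
  have "(\<lambda>\<eta>. restrict (emeasure \<eta>) I) \<in> R \<rightarrow>\<^sub>M Pi\<^sub>M I (\<lambda>_. borel)"
    using I sets by (intro measurable_restrict measurable_count[of _ S]) (auto simp: fmeasurable_def)
  from measurable_compose[OF this f] show ?thesis
    by (rule measurable_cong[THEN iffD2, rotated]) (use v sp in auto)
qed

text \<open>The pi-system for the Dynkin argument. Since membership is expressed by indicators,
  stability under intersection is closure of \<open>cylinder_fun\<close> under products.\<close>

definition cylinder_sets :: "'a measure \<Rightarrow> 'a measure \<Rightarrow> 'a measure set set" where
  "cylinder_sets S \<nu> = {C. C \<subseteq> point_patterns S \<and> cylinder_fun S \<nu> (indicator C)}"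

lemma Int_stable_cylinder_sets: "Int_stable (cylinder_sets S \<nu>)"
proof (rule Int_stableI)
  fix C D assume "C \<in> cylinder_sets S \<nu>" "D \<in> cylinder_sets S \<nu>"
  then have C: "C \<subseteq> point_patterns S" "cylinder_fun S \<nu> (indicator C)"
    and D: "cylinder_fun S \<nu> (indicator D)" by (auto simp: cylinder_sets_def)
  have "cylinder_fun S \<nu> (\<lambda>\<eta>. indicator C \<eta> * indicator D \<eta>)"
    by (rule cylinder_fun_binop[OF C(2) D]) measurable
  also have "(\<lambda>\<eta>. indicator C \<eta> * indicator D \<eta> :: real) = indicator (C \<inter> D)"
    by (simp add: fun_eq_iff indicator_inter_arith)
  finally show "C \<inter> D \<in> cylinder_sets S \<nu>"
    using C(1) by (auto simp: cylinder_sets_def)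
qed

text \<open>For an exhaustion \<open>D k\<close> by sets of finite \<nu>-measure, the count of any B
  is the supremum of the counts of \<open>B \<inter> D k\<close>. Hence counts of sets of finite
  measure already generate the sigma-algebra, although it is defined by the counts of all measurable
  sets.\<close>

lemma sets_point_pattern_space_subset:
  assumes "sigma_finite_measure \<nu>" and sets: "sets \<nu> = sets S"
  shows "sets (point_pattern_space S) \<subseteq> sigma_sets (point_patterns S) (cylinder_sets S \<nu>)"
proof -
  define W where "W = sigma (point_patterns S) (cylinder_sets S \<nu>)"
  have sub: "cylinder_sets S \<nu> \<subseteq> Pow (point_patterns S)" by (auto simp: cylinder_sets_def)
  have sW: "sets W = sigma_sets (point_patterns S) (cylinder_sets S \<nu>)" "space W = point_patterns S"
    using sub by (simp_all add: W_def)
  have fin: "(\<lambda>\<eta>. emeasure \<eta> B) \<in> borel_measurable W" if "B \<in> fmeasurable \<nu>" for B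
  proof (rule measurableI)
    fix A :: "ennreal set" assume [measurable]: "A \<in> sets borel"
    have "cylinder_fun S \<nu> (\<lambda>\<eta>. indicator A (emeasure \<eta> B))"
      by (rule cylinder_fun_count[OF that]) measurable
    also have "?this \<longleftrightarrow> cylinder_fun S \<nu> (indicator ((\<lambda>\<eta>. emeasure \<eta> B) -` A \<inter> point_patterns S))"
      by (intro cylinder_fun_cong) (simp add: indicator_def)
    finally show "(\<lambda>\<eta>. emeasure \<eta> B) -` A \<inter> space W \<in> sets W"
      unfolding sW by (intro sigma_sets.Basic) (simp add: cylinder_sets_def)
  qed simp
  obtain D :: "nat \<Rightarrow> 'a set" where D: "range D \<subseteq> sets \<nu>" "(\<Union>i. D i) = space \<nu>"
    "\<And>i. emeasure \<nu> (D i) \<noteq> \<infinity>" "incseq D"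
    using sigma_finite_measure.sigma_finite_incseq[OF assms(1)] by blast
  have all: "(\<lambda>\<eta>. emeasure \<eta> B) \<in> borel_measurable W" if B: "B \<in> sets S" for B
  proof -
    have BD: "B \<inter> D k \<in> fmeasurable \<nu>" for k
    proof (rule fmeasurableI)
      have "emeasure \<nu> (B \<inter> D k) \<le> emeasure \<nu> (D k)"
        using D by (intro emeasure_mono) auto
      then show "emeasure \<nu> (B \<inter> D k) < \<infinity>" using D(3)[of k] by (simp add: less_top top_unique order_le_less_trans)
      show "B \<inter> D k \<in> sets \<nu>" using B D sets by auto
    qed
    have "(\<lambda>\<eta>. SUP k. emeasure \<eta> (B \<inter> D k)) \<in> borel_measurable W"
      by (intro borel_measurable_SUP fin BD) auto
    also have "?this \<longleftrightarrow> ?thesis"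
    proof (intro measurable_cong)
      fix \<eta> assume "\<eta> \<in> space W"
      then have e: "sets \<eta> = sets S" by (simp add: sW sets_point_pattern)
      have "(SUP k. emeasure \<eta> (B \<inter> D k)) = emeasure \<eta> (\<Union>k. B \<inter> D k)"
        using D(1) B sets e
        by (intro SUP_emeasure_incseq incseq_SucI Int_mono order_refl incseq_SucD[OF D(4)]) auto
      also have "(\<Union>k. B \<inter> D k) = B"
        using D(2) sets.sets_into_space[OF B] sets_eq_imp_space_eq[OF sets] by auto
      finally show "(SUP k. emeasure \<eta> (B \<inter> D k)) = emeasure \<eta> B" .
    qed
    finally show ?thesis .
  qed
  show ?thesis
    unfolding sets_point_pattern_space
  proof (rule sigma_sets_mono, safe)
    fix B and A :: "ennreal set" assume "B \<in> sets S" "A \<in> sets borel"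
    from measurable_sets[OF all[OF this(1)] this(2)]
    show "(\<lambda>\<eta>. emeasure \<eta> B) -` A \<inter> point_patterns S \<in> sigma_sets (point_patterns S) (cylinder_sets S \<nu>)"
      by (simp add: sW)
  qed
qed

text \<open>Membership in the L1(R)-closure of the cylinder functions, for integrable
  \<open>u\<close>. For other \<open>u\<close> the condition says little, as the Bochner integral of
  a non-integrable function is 0; integrability is therefore carried along in the closure
  lemmas.\<close>

definition cylinder_approx :: "'a measure \<Rightarrow> 'a measure \<Rightarrow> 'a measure measure \<Rightarrow> ('a measure \<Rightarrow> real) \<Rightarrow> bool" where
  "cylinder_approx S \<nu> R u \<longleftrightarrow>
     (\<forall>e>0. \<exists>v. cylinder_fun S \<nu> v \<and> integrable R v \<and> (\<integral>\<eta>. \<bar>u \<eta> - v \<eta>\<bar> \<partial>R) < e)"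

lemma cylinder_approxD:
  assumes "cylinder_approx S \<nu> R u" "0 < e"
  obtains v where "cylinder_fun S \<nu> v" "integrable R v" "(\<integral>\<eta>. \<bar>u \<eta> - v \<eta>\<bar> \<partial>R) < e"
  using assms unfolding cylinder_approx_def by blast

lemma cylinder_approx_self: "cylinder_fun S \<nu> v \<Longrightarrow> integrable R v \<Longrightarrow> cylinder_approx S \<nu> R v"
  unfolding cylinder_approx_def by (auto intro!: exI[of _ v])

lemma cylinder_approx_cong:
  assumes "\<And>\<eta>. \<eta> \<in> space R \<Longrightarrow> u \<eta> = w \<eta>"
  shows "cylinder_approx S \<nu> R u \<longleftrightarrow> cylinder_approx S \<nu> R w"
proof -
  have "(\<integral>\<eta>. \<bar>u \<eta> - v \<eta>\<bar> \<partial>R) = (\<integral>\<eta>. \<bar>w \<eta> - v \<eta>\<bar> \<partial>R)" for v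
    using assms by (intro Bochner_Integration.integral_cong) auto
  then show ?thesis by (simp add: cylinder_approx_def)
qed

lemma cylinder_approx_add:
  assumes "cylinder_approx S \<nu> R u" "cylinder_approx S \<nu> R w" "integrable R u" "integrable R w"
  shows "cylinder_approx S \<nu> R (\<lambda>\<eta>. u \<eta> + w \<eta>)"
  unfolding cylinder_approx_def
proof (intro allI impI)
  fix e :: real assume "0 < e"
  then have e: "0 < e / 2" by simp
  obtain v where v: "cylinder_fun S \<nu> v" "integrable R v" "(\<integral>\<eta>. \<bar>u \<eta> - v \<eta>\<bar> \<partial>R) < e / 2"
    by (rule cylinder_approxD[OF assms(1) e])
  obtain v' where v': "cylinder_fun S \<nu> v'" "integrable R v'" "(\<integral>\<eta>. \<bar>w \<eta> - v' \<eta>\<bar> \<partial>R) < e / 2"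
    by (rule cylinder_approxD[OF assms(2) e])
  have "(\<integral>\<eta>. \<bar>(u \<eta> + w \<eta>) - (v \<eta> + v' \<eta>)\<bar> \<partial>R) \<le> (\<integral>\<eta>. \<bar>u \<eta> - v \<eta>\<bar> + \<bar>w \<eta> - v' \<eta>\<bar> \<partial>R)"
    using assms v v' by (intro integral_mono) auto
  also have "\<dots> < e" using assms v v' by (subst Bochner_Integration.integral_add) auto
  finally show "\<exists>v. cylinder_fun S \<nu> v \<and> integrable R v \<and> (\<integral>\<eta>. \<bar>u \<eta> + w \<eta> - v \<eta>\<bar> \<partial>R) < e"
    using v v' cylinder_fun_binop[OF v(1) v'(1), of "(+)"]
    by (intro exI[of _ "\<lambda>\<eta>. v \<eta> + v' \<eta>"]) auto
qed

lemma cylinder_approx_scale: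
  assumes "cylinder_approx S \<nu> R u" "integrable R u"
  shows "cylinder_approx S \<nu> R (\<lambda>\<eta>. c * u \<eta>)"
  unfolding cylinder_approx_def
proof (intro allI impI)
  fix e :: real assume "0 < e"
  \<comment> \<open>The summand 1 covers c = 0.\<close>
  then have "0 < e / (\<bar>c\<bar> + 1)" by (simp add: add_nonneg_pos)
  then obtain v where v: "cylinder_fun S \<nu> v" "integrable R v"
    "(\<integral>\<eta>. \<bar>u \<eta> - v \<eta>\<bar> \<partial>R) < e / (\<bar>c\<bar> + 1)"
    by (rule cylinder_approxD[OF assms(1)])
  have "(\<integral>\<eta>. \<bar>c * u \<eta> - c * v \<eta>\<bar> \<partial>R) = \<bar>c\<bar> * (\<integral>\<eta>. \<bar>u \<eta> - v \<eta>\<bar> \<partial>R)"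
    by (simp add: abs_mult right_diff_distrib[symmetric])
  also have "\<dots> \<le> (\<bar>c\<bar> + 1) * (\<integral>\<eta>. \<bar>u \<eta> - v \<eta>\<bar> \<partial>R)"
    by (intro mult_right_mono) auto
  also have "\<dots> < e" using v(3) by (simp add: pos_less_divide_eq mult.commute add_nonneg_pos)
  finally show "\<exists>v. cylinder_fun S \<nu> v \<and> integrable R v \<and> (\<integral>\<eta>. \<bar>c * u \<eta> - v \<eta>\<bar> \<partial>R) < e"
    using v cylinder_fun_binop[OF v(1) v(1), of "\<lambda>x y. c * x"]
    by (intro exI[of _ "\<lambda>\<eta>. c * v \<eta>"]) auto
qed

text \<open>Dominated convergence makes some \<open>s i\<close> close to \<open>u\<close> in L1, and
  a cylinder function close to that \<open>s i\<close> finishes by the triangle inequality. It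
  serves both the disjoint unions in the Dynkin argument and the limits of simple functions.\<close>

lemma cylinder_approx_lim:
  assumes s: "\<And>i. cylinder_approx S \<nu> R (s i)" "\<And>i. integrable R (s i)" and u: "integrable R u"
    and lim: "\<And>\<eta>. \<eta> \<in> space R \<Longrightarrow> (\<lambda>i. s i \<eta>) \<longlonglongrightarrow> u \<eta>"
    and bound: "\<And>i \<eta>. \<eta> \<in> space R \<Longrightarrow> \<bar>s i \<eta>\<bar> \<le> w \<eta>" and w: "integrable R w"
  shows "cylinder_approx S \<nu> R u"
  unfolding cylinder_approx_def
proof (intro allI impI)
  fix e :: real assume "0 < e"
  then have e: "0 < e / 2" by simp
  have "(\<lambda>i. \<integral>\<eta>. \<bar>u \<eta> - s i \<eta>\<bar> \<partial>R) \<longlonglongrightarrow> (\<integral>\<eta>. 0 \<partial>R)"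
  proof (rule integral_dominated_convergence[where w = "\<lambda>\<eta>. \<bar>u \<eta>\<bar> + w \<eta>"])
    show "AE \<eta> in R. (\<lambda>i. \<bar>u \<eta> - s i \<eta>\<bar>) \<longlonglongrightarrow> 0"
    proof (rule AE_I2)
      fix \<eta> assume "\<eta> \<in> space R"
      from tendsto_rabs[OF tendsto_diff[OF tendsto_const[of "u \<eta>"] lim[OF this]]]
      show "(\<lambda>i. \<bar>u \<eta> - s i \<eta>\<bar>) \<longlonglongrightarrow> 0" by simp
    qed
    show "AE \<eta> in R. norm \<bar>u \<eta> - s i \<eta>\<bar> \<le> \<bar>u \<eta>\<bar> + w \<eta>" for i
    proof (rule AE_I2)
      fix \<eta> assume "\<eta> \<in> space R"
      from bound[OF this, of i] show "norm \<bar>u \<eta> - s i \<eta>\<bar> \<le> \<bar>u \<eta>\<bar> + w \<eta>" by simp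
    qed
  qed (use s u w in auto)
  then have "\<forall>\<^sub>F i in sequentially. (\<integral>\<eta>. \<bar>u \<eta> - s i \<eta>\<bar> \<partial>R) < e / 2"
    using e by (intro order_tendstoD(2)) auto
  then obtain i where i: "(\<integral>\<eta>. \<bar>u \<eta> - s i \<eta>\<bar> \<partial>R) < e / 2"
    using eventually_happens'[OF sequentially_bot] by blast
  obtain v where v: "cylinder_fun S \<nu> v" "integrable R v" "(\<integral>\<eta>. \<bar>s i \<eta> - v \<eta>\<bar> \<partial>R) < e / 2"
    by (rule cylinder_approxD[OF s(1) e])
  have "(\<integral>\<eta>. \<bar>u \<eta> - v \<eta>\<bar> \<partial>R) \<le> (\<integral>\<eta>. \<bar>u \<eta> - s i \<eta>\<bar> + \<bar>s i \<eta> - v \<eta>\<bar> \<partial>R)"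
    using u s(2)[of i] v by (intro integral_mono) auto
  also have "\<dots> < e" using u s(2)[of i] v i by (subst Bochner_Integration.integral_add) auto
  finally show "\<exists>v. cylinder_fun S \<nu> v \<and> integrable R v \<and> (\<integral>\<eta>. \<bar>u \<eta> - v \<eta>\<bar> \<partial>R) < e"
    using v by blast
qed

text \<open>Dynkin's pi-lambda argument: the sets with approximable indicator include the cylinder
  sets and are closed under complements and countable disjoint unions. Finiteness of R makes the
  constant 1 integrable, both as a summand for complements and as the dominating function for
  unions.\<close>

lemma cylinder_approx_indicator:
  assumes "finite_measure R" and sets_R: "sets R = sets (point_pattern_space S)"
    and "sigma_finite_measure \<nu>" and sets: "sets \<nu> = sets S" and C: "C \<in> sets R"
  shows "cylinder_approx S \<nu> R (indicator C)"
proof -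
  interpret finite_measure R by fact
  have sp: "space R = point_patterns S"
    using sets_eq_imp_space_eq[OF sets_R] by (simp add: space_point_pattern_space)
  have sub: "cylinder_sets S \<nu> \<subseteq> Pow (point_patterns S)" by (auto simp: cylinder_sets_def)
  have cyl_R: "D \<in> sets R" if "D \<in> cylinder_sets S \<nu>" for D
  proof -
    have D: "D \<subseteq> space R" "cylinder_fun S \<nu> (indicator D)" using that by (auto simp: cylinder_sets_def sp)
    have "(indicator D :: _ \<Rightarrow> real) \<in> borel_measurable R"
      by (rule cylinder_fun_measurable[OF D(2) sets sets_R])
    then have "D \<inter> space R \<in> sets R" by (simp only: borel_measurable_indicator_iff)
    also have "D \<inter> space R = D" using D(1) by blast
    finally show ?thesis .
  qed
  have sig_R: "sigma_sets (point_patterns S) (cylinder_sets S \<nu>) \<subseteq> sets R"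
    unfolding sp[symmetric] by (rule sets.sigma_sets_subset) (use cyl_R in blast)
  have int: "integrable R (indicator D :: _ \<Rightarrow> real)" if "D \<in> sets R" for D
    using that by (intro integrable_real_indicator) (simp_all add: emeasure_eq_measure)
  have "C \<in> sigma_sets (point_patterns S) (cylinder_sets S \<nu>)"
    using sets_point_pattern_space_subset[OF assms(3,4)] C sets_R by auto
  with Int_stable_cylinder_sets sub show ?thesis
  proof (induction rule: sigma_sets_induct_disjoint)
    case (basic D)
    then show ?case using cyl_R by (intro cylinder_approx_self int) (auto simp: cylinder_sets_def)
  next
    case empty
    have "cylinder_fun S \<nu> (indicator {})"
      using cylinder_fun_const[of S \<nu> 0]
      by (rule cylinder_fun_cong[THEN iffD1, rotated]) simp
    then show ?case by (rule cylinder_approx_self) simp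
  next
    case (compl D)
    have D: "D \<in> sets R" using compl sig_R by auto
    have 1: "cylinder_approx S \<nu> R (\<lambda>_. 1)"
      by (rule cylinder_approx_self[OF cylinder_fun_const]) simp
    have 2: "cylinder_approx S \<nu> R (\<lambda>\<eta>. (-1) * indicator D \<eta>)"
      by (rule cylinder_approx_scale[OF compl(2) int[OF D]])
    have "cylinder_approx S \<nu> R (\<lambda>\<eta>. 1 + (-1) * indicator D \<eta>)"
      by (rule cylinder_approx_add[OF 1 2]) (use int[OF D] in auto)
    then show ?case
      by (rule cylinder_approx_cong[THEN iffD1, rotated]) (simp add: sp indicator_def)
  next
    case (union A)
    have A: "A i \<in> sets R" for i using union sig_R by auto
    let ?s = "\<lambda>n \<eta>. \<Sum>i<n. indicator (A i) \<eta> :: real"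
    have s_int: "integrable R (?s n)" for n using int[OF A] by (intro Bochner_Integration.integrable_sum)
    have s_app: "cylinder_approx S \<nu> R (?s n)" for n
    proof (induction n)
      case 0
      then show ?case by (simp add: cylinder_approx_self cylinder_fun_const)
    next
      case (Suc n)
      then show ?case
        using union(3) s_int[of n] int[OF A] by (simp add: cylinder_approx_add)
    qed
    have s_eq: "?s n \<eta> = indicator (\<Union>i<n. A i) \<eta>" for n \<eta>
      using union(1) by (subst indicator_UN_disjoint) (auto simp: disjoint_family_on_def)
    show ?case
    proof (rule cylinder_approx_lim[where s = ?s and w = "\<lambda>_. 1"])
      fix \<eta>
      show "(\<lambda>n. ?s n \<eta>) \<longlonglongrightarrow> indicator (\<Union>i. A i) \<eta>"
        unfolding s_eq by (rule LIMSEQ_indicator_UN)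
      show "\<bar>?s n \<eta>\<bar> \<le> 1" for n unfolding s_eq by (simp add: indicator_def)
    qed (use s_app s_int A in \<open>auto intro!: int\<close>)
  qed
qed

lemma cylinder_approx_integrable:
  assumes "finite_measure R" "sets R = sets (point_pattern_space S)"
    and "sigma_finite_measure \<nu>" "sets \<nu> = sets S" and "integrable R u"
  shows "cylinder_approx S \<nu> R u"
  using assms(5)
proof (induction rule: integrable_induct)
  case (base A c)
  have "cylinder_approx S \<nu> R (\<lambda>x. c * indicator A x)"
    using base cylinder_approx_indicator[OF assms(1-4)]
    by (intro cylinder_approx_scale) auto
  then show ?case by (simp add: mult.commute)
next
  case (add f g)
  then show ?case by (intro cylinder_approx_add)
next
  case (lim f s)
  show ?case
    by (rule cylinder_approx_lim[where s = s and w = "\<lambda>\<eta>. 2 * \<bar>f \<eta>\<bar>"]) (use lim in auto)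
qed

text \<open>The sets \<open>C i\<close> are the atoms of the finite ring generated by \<open>I\<close>.\<close>

lemma disjoint_refinement:
  assumes "finite I" "I \<subseteq> fmeasurable \<nu>"
  obtains n :: nat and C :: "nat \<Rightarrow> 'a set" and K :: "'a set \<Rightarrow> nat set"
  where "0 < n" "\<And>i. C i \<in> fmeasurable \<nu>" "disjoint_family_on C {..<n}"
    "\<And>B. B \<in> I \<Longrightarrow> K B \<subseteq> {..<n} \<and> B = (\<Union>i\<in>K B. C i)"
proof -
  obtain e where e: "bij_betw e {0..<card (Pow I)} (Pow I)"
    using ex_bij_betw_nat_finite[of "Pow I"] \<open>finite I\<close> by auto
  define n where "n = card (Pow I)"
  have e: "bij_betw e {..<n} (Pow I)" using e by (simp add: n_def atLeast0LessThan)
  \<comment> \<open>\<open>e\<close> enumerates the subfamilies of I, and \<open>C i\<close>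
    collects the points lying in exactly the members of \<open>e i\<close>. Staying inside the union
    of I makes the atom of the empty subfamily empty instead of a complement of possibly infinite
    measure.\<close>
  define C where "C i = {x \<in> \<Union>I. {B \<in> I. x \<in> B} = e i}" for i
  define K where "K B = {i. i < n \<and> B \<in> e i}" for B
  have UI: "\<Union>I \<in> fmeasurable \<nu>"
    using assms by (intro fmeasurable.finite_Union) auto
  show ?thesis
  proof
    show "0 < n" using \<open>finite I\<close> by (simp add: n_def card_Pow)
    fix i
    have sI: "B \<in> sets \<nu>" if "B \<in> I" for B using that assms by auto
    \<comment> \<open>For i from n on, \<open>e i\<close> is unspecified and may fail to be a
      subfamily of I. Then no point has this membership pattern and the set is empty, so
      measurability holds for all i.\<close>
    have "C i = (if e i \<subseteq> I then \<Union>I \<inter> {x \<in> space \<nu>. \<forall>B\<in>I. x \<in> B \<longleftrightarrow> B \<in> e i} else {})"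
      using sI[THEN sets.sets_into_space] by (auto simp: C_def set_eq_iff)
    also have "\<dots> \<in> fmeasurable \<nu>"
    proof (cases "e i \<subseteq> I")
      case True
      have "{x \<in> space \<nu>. \<forall>B\<in>I. x \<in> B \<longleftrightarrow> B \<in> e i} \<in> sets \<nu>"
      proof (rule sets.sets_Collect_finite_All)
        fix B assume "B \<in> I"
        then have [measurable]: "B \<in> sets \<nu>" by (rule sI)
        show "{x \<in> space \<nu>. x \<in> B \<longleftrightarrow> B \<in> e i} \<in> sets \<nu>" by measurable
      qed fact
      then show ?thesis using True UI by (auto intro: fmeasurable_Int_fmeasurable)
    qed simp
    finally show "C i \<in> fmeasurable \<nu>" .
  next
    show "disjoint_family_on C {..<n}"
      using e by (auto simp: disjoint_family_on_def C_def bij_betw_def inj_on_def)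
  next
    fix B assume "B \<in> I"
    show "K B \<subseteq> {..<n} \<and> B = (\<Union>i\<in>K B. C i)"
    proof (intro conjI set_eqI iffI)
      show "K B \<subseteq> {..<n}" by (auto simp: K_def)
      fix x
      show "x \<in> B" if "x \<in> (\<Union>i\<in>K B. C i)" using that by (auto simp: K_def C_def)
      assume "x \<in> B"
      have "{B \<in> I. x \<in> B} \<in> e ` {..<n}"
        unfolding bij_betw_imp_surj_on[OF e] by auto
      then obtain i where i: "i < n" "{B \<in> I. x \<in> B} = e i" by (elim imageE) simp
      have "i \<in> K B" "x \<in> C i"
        using \<open>x \<in> B\<close> \<open>B \<in> I\<close> i by (auto simp: K_def C_def)
      then show "x \<in> (\<Union>i\<in>K B. C i)" by blast
    qed
  qed
qed

text \<open>By additivity of \<eta> the count of each B in I is the sum of the counts of its atoms.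
  This brings the function into the form to which independence over disjoint sets applies.\<close>

lemma cylinder_fun_counts:
  assumes v: "cylinder_fun S \<nu> v" and sets: "sets \<nu> = sets S"
  obtains n :: nat and C :: "nat \<Rightarrow> 'a set" and g
  where "0 < n" "\<And>i. C i \<in> fmeasurable \<nu>" "disjoint_family_on C {..<n}"
    "g \<in> borel_measurable (Pi\<^sub>M {..<n} (\<lambda>_. borel))"
    "\<And>\<eta>. \<eta> \<in> point_patterns S \<Longrightarrow> v \<eta> = g (counts n C \<eta>)"
proof -
  obtain I f where I: "finite I" "I \<subseteq> fmeasurable \<nu>" and f: "f \<in> borel_measurable (Pi\<^sub>M I (\<lambda>_. borel))"
    and v: "\<forall>\<eta>\<in>point_patterns S. v \<eta> = f (restrict (emeasure \<eta>) I)"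
    using v unfolding cylinder_fun_def by blast
  show thesis
  proof (rule disjoint_refinement[OF I])
    fix n :: nat and C :: "nat \<Rightarrow> 'a set" and K
    assume n: "0 < n" and C: "\<And>i. C i \<in> fmeasurable \<nu>"
      and disj: "disjoint_family_on C {..<n}"
      and K: "\<And>B. B \<in> I \<Longrightarrow> K B \<subseteq> {..<n} \<and> B = (\<Union>i\<in>K B. C i)"
    let ?h = "\<lambda>x. \<lambda>B\<in>I. \<Sum>i\<in>K B. x i :: ennreal"
    have "?h \<in> Pi\<^sub>M {..<n} (\<lambda>_. borel) \<rightarrow>\<^sub>M Pi\<^sub>M I (\<lambda>_. borel)"
    proof (intro measurable_restrict borel_measurable_sum)
      fix B i assume "B \<in> I" "i \<in> K B"
      then have "i \<in> {..<n}" using K by blast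
      then show "(\<lambda>x. x i) \<in> borel_measurable (Pi\<^sub>M {..<n} (\<lambda>_. borel))"
        by (rule measurable_component_singleton)
    qed
    from measurable_compose[OF this f]
    have g: "(\<lambda>x. f (?h x)) \<in> borel_measurable (Pi\<^sub>M {..<n} (\<lambda>_. borel))" .
    have "v \<eta> = f (?h (counts n C \<eta>))" if \<eta>: "\<eta> \<in> point_patterns S" for \<eta>
    proof -
      have "emeasure \<eta> B = (\<Sum>i\<in>K B. counts n C \<eta> i)" if "B \<in> I" for B
      proof -
        have KB: "K B \<subseteq> {..<n}" "B = (\<Union>i\<in>K B. C i)" using K[OF that] by auto
        have "(\<Sum>i\<in>K B. counts n C \<eta> i) = (\<Sum>i\<in>K B. emeasure \<eta> (C i))"
          using KB by (intro sum.cong) (auto simp: counts_def)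
        also have "\<dots> = emeasure \<eta> (\<Union>i\<in>K B. C i)"
          using C KB disj sets sets_point_pattern[OF \<eta>]
          by (intro sum_emeasure) (auto intro: disjoint_family_on_mono finite_subset)
        finally show ?thesis using KB by simp
      qed
      then have "restrict (emeasure \<eta>) I = ?h (counts n C \<eta>)" by auto
      then show ?thesis using v \<eta> by simp
    qed
    from that[OF n C disj g this] show thesis .
  qed
qed

section \<open>The Hellinger distance of Poisson processes\<close>

lemma hellinger_power2_eq:
  assumes "hellinger_dominated L M \<nu> f g"
  shows "(hellinger L M)\<^sup>2 = (\<integral>\<^sup>+x. ennreal ((sqrt (f x) - sqrt (g x))\<^sup>2) \<partial>\<nu>) / 2"
  by (simp add: hellinger_eq[OF assms] hellinger_wrt_def sqrt_ennreal_power2)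

text \<open>For probability measures the expanded square reads D + 2A = 2. In this additive form it
  also shows that both D and A are finite, after which real arithmetic takes over.\<close>

lemma hellinger_power2_affinity:
  assumes dom: "hellinger_dominated P Q R p q" and "prob_space P" "prob_space Q"
  obtains \<alpha> where "0 \<le> \<alpha>" "\<alpha> \<le> 1" "(\<integral>\<^sup>+x. ennreal (sqrt (p x * q x)) \<partial>R) = ennreal \<alpha>"
    "(hellinger P Q)\<^sup>2 = ennreal (1 - \<alpha>)"
proof -
  have [measurable]: "p \<in> borel_measurable R" "q \<in> borel_measurable R"
    and pq: "\<And>x. 0 \<le> p x" "\<And>x. 0 \<le> q x"
    and P: "density R (\<lambda>x. ennreal (p x)) = P" and Q: "density R (\<lambda>x. ennreal (q x)) = Q"
    using dom by (auto simp: hellinger_dominated_def)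
  have mass: "(\<integral>\<^sup>+x. ennreal (p x) \<partial>R) = 1" "(\<integral>\<^sup>+x. ennreal (q x) \<partial>R) = 1"
    using prob_space.emeasure_space_1[OF assms(2)] prob_space.emeasure_space_1[OF assms(3)]
    unfolding P[symmetric] Q[symmetric] by (auto simp: emeasure_density cong: nn_integral_cong)
  let ?D = "\<integral>\<^sup>+x. ennreal ((sqrt (p x) - sqrt (q x))\<^sup>2) \<partial>R"
  let ?A = "\<integral>\<^sup>+x. ennreal (sqrt (p x * q x)) \<partial>R"
  have "?D + 2 * ?A = (\<integral>\<^sup>+x. ennreal ((sqrt (p x) - sqrt (q x))\<^sup>2) + 2 * ennreal (sqrt (p x * q x)) \<partial>R)"
    by (simp add: nn_integral_add nn_integral_cmult)
  also have "\<dots> = (\<integral>\<^sup>+x. ennreal (p x) + ennreal (q x) \<partial>R)"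
  proof (intro nn_integral_cong)
    fix x
    have "ennreal ((sqrt (p x) - sqrt (q x))\<^sup>2) + ennreal (2 * sqrt (p x * q x)) =
        ennreal ((sqrt (p x) - sqrt (q x))\<^sup>2 + 2 * sqrt (p x * q x))"
      using pq by (intro ennreal_plus[symmetric]) auto
    also have "(sqrt (p x) - sqrt (q x))\<^sup>2 + 2 * sqrt (p x * q x) = p x + q x"
      using pq by (simp add: power2_diff real_sqrt_mult)
    finally show "ennreal ((sqrt (p x) - sqrt (q x))\<^sup>2) + 2 * ennreal (sqrt (p x * q x)) =
        ennreal (p x) + ennreal (q x)"
      using pq by (simp add: ennreal_mult)
  qed
  also have "\<dots> = 2" by (simp add: nn_integral_add mass)
  finally have sum: "?D + 2 * ?A = 2" .
  obtain \<alpha> where \<alpha>: "?A = ennreal \<alpha>" "0 \<le> \<alpha>"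
    using sum by (cases ?A) (auto simp: ennreal_mult_top)
  obtain d where d: "?D = ennreal d" "0 \<le> d" using sum by (cases ?D) auto
  have "ennreal (d + 2 * \<alpha>) = ennreal 2"
    using sum \<alpha> d by (simp add: ennreal_plus ennreal_mult)
  then have eq: "d + 2 * \<alpha> = 2" using \<alpha> d by (subst (asm) ennreal_inj) auto
  have "(hellinger P Q)\<^sup>2 = ennreal d / ennreal 2"
    unfolding hellinger_power2_eq[OF dom] d by simp
  also have "\<dots> = ennreal (d / 2)" using d by (intro divide_ennreal) auto
  also have "d / 2 = 1 - \<alpha>" using eq by simp
  finally show ?thesis using \<alpha> d eq by (intro that[of \<alpha>]) auto
qed

lemma counts_density:
  assumes P: "poisson_PP S \<Lambda> P" and "0 < n"
    and "\<And>i. B i \<in> sets S" "disjoint_family_on B {..<n}" and fin: "\<And>i. emeasure \<Lambda> (B i) \<noteq> \<infinity>"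
  shows "distr P (Pi\<^sub>M {..<n} (\<lambda>_. borel)) (counts n B) =
      density (poisson_base_PiM n) (\<lambda>x. ennreal (poisson_dens_PiM n (\<lambda>i. measure \<Lambda> (B i)) x))"
    and "(\<integral>\<^sup>+x. ennreal (poisson_dens_PiM n (\<lambda>i. measure \<Lambda> (B i)) x) \<partial>poisson_base_PiM n) \<le> 1"
proof -
  let ?d = "poisson_dens_PiM n (\<lambda>i. measure \<Lambda> (B i))"
  show *: "distr P (Pi\<^sub>M {..<n} (\<lambda>_. borel)) (counts n B) =
      density (poisson_base_PiM n) (\<lambda>x. ennreal (?d x))"
    using fin by (intro distr_counts[OF P]) (auto simp: assms intro!: emeasure_eq_ennreal_measure)
  have "prob_space (distr P (Pi\<^sub>M {..<n} (\<lambda>_. borel)) (counts n B))"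
    using P assms(3) by (intro prob_space.prob_space_distr measurable_counts) (auto simp: poisson_PP_def)
  from prob_space.emeasure_space_1[OF this]
  have "(\<integral>\<^sup>+x. ennreal (?d x) * indicator (space (poisson_base_PiM n)) x \<partial>poisson_base_PiM n) = 1"
    unfolding * by (simp only: space_density) (subst (asm) emeasure_density, auto)
  also have "(\<integral>\<^sup>+x. ennreal (?d x) * indicator (space (poisson_base_PiM n)) x \<partial>poisson_base_PiM n) =
     (\<integral>\<^sup>+x. ennreal (?d x) \<partial>poisson_base_PiM n)"
    by (intro nn_integral_cong) auto
  finally show "(\<integral>\<^sup>+x. ennreal (?d x) \<partial>poisson_base_PiM n) \<le> 1" by simp
qed

text \<open>For p, q in [0,1] the map t to t p + q/t has Lipschitz constant 1 + 1/l^2 on [l,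
  \<infinity>): the first term contributes at most 1, the reciprocal at most 1/l^2. Hence
  L1(R)-closeness of two weights controls both integrals at once.\<close>

lemma weighted_sum_perturb:
  assumes [measurable]: "p \<in> borel_measurable R" "q \<in> borel_measurable R"
      "\<psi> \<in> borel_measurable R" "\<phi> \<in> borel_measurable R"
    and pq: "\<And>x. 0 \<le> p x" "\<And>x. p x \<le> 1" "\<And>x. 0 \<le> q x" "\<And>x. q x \<le> 1"
    and lo: "0 < l" "\<And>x. l \<le> \<psi> x" "\<And>x. l \<le> \<phi> x"
  shows "(\<integral>\<^sup>+x. ennreal (\<phi> x) \<partial>density R (\<lambda>x. ennreal (p x))) +
      (\<integral>\<^sup>+x. ennreal (1 / \<phi> x) \<partial>density R (\<lambda>x. ennreal (q x))) \<le>
      (\<integral>\<^sup>+x. ennreal (\<psi> x) \<partial>density R (\<lambda>x. ennreal (p x))) +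
      (\<integral>\<^sup>+x. ennreal (1 / \<psi> x) \<partial>density R (\<lambda>x. ennreal (q x))) +
      ennreal (1 + 1 / l\<^sup>2) * (\<integral>\<^sup>+x. ennreal \<bar>\<psi> x - \<phi> x\<bar> \<partial>R)"
proof -
  have pos: "0 < \<psi> x" "0 < \<phi> x" for x using lo(1) lo(2,3)[of x] by auto
  have "\<phi> x * p x + q x / \<phi> x \<le> \<psi> x * p x + q x / \<psi> x + (1 + 1 / l\<^sup>2) * \<bar>\<psi> x - \<phi> x\<bar>" for x
  proof -
    let ?d = "\<bar>\<psi> x - \<phi> x\<bar>"
    have "(\<phi> x - \<psi> x) * p x \<le> ?d * 1"
      using pq(1,2)[of x] by (intro mult_mono) auto
    moreover have "(1 / \<phi> x - 1 / \<psi> x) * q x \<le> (?d / l\<^sup>2) * 1"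
    proof (intro mult_mono)
      have "1 / \<phi> x - 1 / \<psi> x = (\<psi> x - \<phi> x) / (\<phi> x * \<psi> x)"
        using pos[of x] by (simp add: field_simps)
      also have "\<dots> \<le> ?d / (\<phi> x * \<psi> x)"
        using pos[of x] by (intro divide_right_mono) auto
      also have "\<dots> \<le> ?d / l\<^sup>2"
        using lo pos[of x] unfolding power2_eq_square by (intro divide_left_mono mult_mono) (auto intro: less_imp_le)
      finally show "1 / \<phi> x - 1 / \<psi> x \<le> ?d / l\<^sup>2" .
    qed (use pq[of x] in auto)
    ultimately show ?thesis by (simp add: algebra_simps)
  qed
  then have "(\<integral>\<^sup>+x. ennreal (\<phi> x * p x + q x / \<phi> x) \<partial>R) \<le>
     (\<integral>\<^sup>+x. ennreal (\<psi> x * p x + q x / \<psi> x + (1 + 1 / l\<^sup>2) * \<bar>\<psi> x - \<phi> x\<bar>) \<partial>R)"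
    by (intro nn_integral_mono ennreal_leI)
  also have "\<dots> = (\<integral>\<^sup>+x. ennreal (\<psi> x * p x + q x / \<psi> x) + ennreal (1 + 1 / l\<^sup>2) * ennreal \<bar>\<psi> x - \<phi> x\<bar> \<partial>R)"
  proof (intro nn_integral_cong)
    fix x
    have "ennreal (\<psi> x * p x + q x / \<psi> x + (1 + 1 / l\<^sup>2) * \<bar>\<psi> x - \<phi> x\<bar>) =
      ennreal (\<psi> x * p x + q x / \<psi> x) + ennreal ((1 + 1 / l\<^sup>2) * \<bar>\<psi> x - \<phi> x\<bar>)"
      using pos[of x] pq[of x] by (intro ennreal_plus) (auto intro!: add_nonneg_nonneg mult_nonneg_nonneg)
    then show "ennreal (\<psi> x * p x + q x / \<psi> x + (1 + 1 / l\<^sup>2) * \<bar>\<psi> x - \<phi> x\<bar>) =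
      ennreal (\<psi> x * p x + q x / \<psi> x) + ennreal (1 + 1 / l\<^sup>2) * ennreal \<bar>\<psi> x - \<phi> x\<bar>"
      by (simp only: ennreal_mult'' abs_ge_zero)
  qed
  also have "\<dots> = (\<integral>\<^sup>+x. ennreal (\<psi> x * p x + q x / \<psi> x) \<partial>R) +
      ennreal (1 + 1 / l\<^sup>2) * (\<integral>\<^sup>+x. ennreal \<bar>\<psi> x - \<phi> x\<bar> \<partial>R)"
    by (subst nn_integral_add, simp, simp, subst nn_integral_cmult, simp, rule refl)
  finally show ?thesis
    using pq pos by (simp add: nn_integral_weighted_sum)
qed

text \<open>The counts of a partition that captures r have product laws of affinity at most
  exp(-r/2), and passing to counts does not lower the affinity. Stating the bound for every real r
  below the integral lets one lemma serve finite and infinite distance.\<close>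

lemma poisson_affinity_le:
  assumes sets: "sets \<nu> = sets S" and "sigma_finite_measure \<nu>"
    and [measurable]: "f \<in> borel_measurable \<nu>" and f: "\<And>x. 0 \<le> f x" "\<And>x. f x \<le> 1"
    and \<Lambda>: "density \<nu> (\<lambda>x. ennreal (f x)) = \<Lambda>" and M: "density \<nu> (\<lambda>x. ennreal (1 - f x)) = M"
    and fin: "\<And>B. B \<in> fmeasurable \<nu> \<Longrightarrow> emeasure \<Lambda> B \<noteq> \<infinity>" "\<And>B. B \<in> fmeasurable \<nu> \<Longrightarrow> emeasure M B \<noteq> \<infinity>"
    and PP: "poisson_PP S \<Lambda> P" "poisson_PP S M Q"
    and dom: "hellinger_dominated P Q R p q"
    and r: "0 \<le> r" "ennreal r < (\<integral>\<^sup>+x. ennreal ((sqrt (f x) - sqrt (1 - f x))\<^sup>2) \<partial>\<nu>)"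
  shows "(\<integral>\<^sup>+x. ennreal (sqrt (p x * q x)) \<partial>R) \<le> ennreal (exp (- (r / 2)))"
proof -
  have [measurable]: "p \<in> borel_measurable R" "q \<in> borel_measurable R"
    and pq: "\<And>x. 0 \<le> p x" "\<And>x. 0 \<le> q x"
    and P: "density R (\<lambda>x. ennreal (p x)) = P" and Q: "density R (\<lambda>x. ennreal (q x)) = Q"
    using dom by (auto simp: hellinger_dominated_def)
  have sR: "sets R = sets (point_pattern_space S)"
    using PP(1) arg_cong[OF P, of sets] by (simp add: poisson_PP_def)
  obtain n :: nat and B :: "nat \<Rightarrow> 'a set" where n: "0 < n" and B: "\<And>i. B i \<in> sets \<nu>" "disjoint_family B"
    "\<And>i. emeasure \<nu> (B i) \<noteq> \<infinity>"
    and le: "r \<le> (\<Sum>i<n. (sqrt (measure \<Lambda> (B i)) - sqrt (measure M (B i)))\<^sup>2)"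
    using hellinger_wrt_partition[OF assms(2,3) f r(2,1)] unfolding \<Lambda> M by blast
  have Bf: "B i \<in> fmeasurable \<nu>" for i using B by (auto intro!: fmeasurableI simp: less_top)
  have BS: "B i \<in> sets S" for i using B sets by simp
  have disj: "disjoint_family_on B {..<n}" using B(2) by (auto simp: disjoint_family_on_def)
  let ?a = "\<lambda>i. measure \<Lambda> (B i)" and ?b = "\<lambda>i. measure M (B i)"
  note dP = counts_density[OF PP(1) n BS disj fin(1)[OF Bf]]
  note dQ = counts_density[OF PP(2) n BS disj fin(2)[OF Bf]]
  have "(\<integral>\<^sup>+x. ennreal (sqrt (p x * q x)) \<partial>R) \<le>
     (\<integral>\<^sup>+x. ennreal (sqrt (poisson_dens_PiM n ?a x * poisson_dens_PiM n ?b x)) \<partial>poisson_base_PiM n)"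
  proof (rule affinity_le_affinity_distr[where T = "counts n B" and U = "Pi\<^sub>M {..<n} (\<lambda>_. borel)"])
    show "counts n B \<in> R \<rightarrow>\<^sub>M Pi\<^sub>M {..<n} (\<lambda>_. borel)"
      by (rule measurable_counts[OF sR BS])
    show "finite_measure (poisson_base_PiM n)"
      by (rule prob_space.finite_measure[OF prob_space_poisson_base_PiM])
  qed (use pq dP dQ in \<open>auto simp: P Q intro!: poisson_dens_PiM_nonneg\<close>)
  also have "\<dots> = ennreal (exp (- ((\<Sum>i<n. (sqrt (?a i) - sqrt (?b i))\<^sup>2) / 2)))"
    by (rule nn_integral_sqrt_poisson_dens_PiM) auto
  also have "\<dots> \<le> ennreal (exp (- (r / 2)))"
    using le by (intro ennreal_leI) simp
  finally show ?thesis .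
qed

text \<open>A near-optimal weight \<psi> is replaced by a weight \<phi> that is a function of
  finitely many counts, at small cost. For \<phi> the weighted sum is one for the count laws, so it
  is at least twice their affinity, and that is at least exp(-h/2) for every choice of disjoint
  sets.\<close>

lemma poisson_affinity_ge:
  assumes sets: "sets \<nu> = sets S" and sf: "sigma_finite_measure \<nu>"
    and [measurable]: "f \<in> borel_measurable \<nu>" "g \<in> borel_measurable \<nu>"
    and fg: "\<And>x. 0 \<le> f x" "\<And>x. 0 \<le> g x"
    and \<Lambda>: "density \<nu> (\<lambda>x. ennreal (f x)) = \<Lambda>" and M: "density \<nu> (\<lambda>x. ennreal (g x)) = M"
    and fin: "\<And>B. B \<in> fmeasurable \<nu> \<Longrightarrow> emeasure \<Lambda> B \<noteq> \<infinity>" "\<And>B. B \<in> fmeasurable \<nu> \<Longrightarrow> emeasure M B \<noteq> \<infinity>"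
    and PP: "poisson_PP S \<Lambda> P" "poisson_PP S M Q"
    and dom: "hellinger_dominated P Q R p q" and R: "finite_measure R"
    and pq1: "\<And>x. p x \<le> 1" "\<And>x. q x \<le> 1"
    and h: "(\<integral>\<^sup>+x. ennreal ((sqrt (f x) - sqrt (g x))\<^sup>2) \<partial>\<nu>) = ennreal h" "0 \<le> h"
  shows "ennreal (exp (- (h / 2))) \<le> (\<integral>\<^sup>+x. ennreal (sqrt (p x * q x)) \<partial>R)"
proof -
  have [measurable]: "p \<in> borel_measurable R" "q \<in> borel_measurable R"
    and pq: "\<And>x. 0 \<le> p x" "\<And>x. 0 \<le> q x"
    and P: "density R (\<lambda>x. ennreal (p x)) = P" and Q: "density R (\<lambda>x. ennreal (q x)) = Q"
    using dom by (auto simp: hellinger_dominated_def)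
  have sR: "sets R = sets (point_pattern_space S)"
    using PP(1) arg_cong[OF P, of sets] by (simp add: poisson_PP_def)
  have spR: "space R = point_patterns S"
    using sets_eq_imp_space_eq[OF sR] by (simp add: space_point_pattern_space)
  interpret R: finite_measure R by fact
  have mass: "(\<integral>\<^sup>+x. ennreal (p x) \<partial>R) \<le> 1" "(\<integral>\<^sup>+x. ennreal (q x) \<partial>R) \<le> 1"
  proof -
    have "emeasure (density R (\<lambda>x. ennreal (p x))) (space R) \<le> 1"
      "emeasure (density R (\<lambda>x. ennreal (q x))) (space R) \<le> 1"
      using PP unfolding P Q by (auto simp: poisson_PP_def intro!: prob_space.emeasure_le_1)
    then show "(\<integral>\<^sup>+x. ennreal (p x) \<partial>R) \<le> 1" "(\<integral>\<^sup>+x. ennreal (q x) \<partial>R) \<le> 1"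
      by (simp_all add: emeasure_density cong: nn_integral_cong)
  qed
  let ?A = "\<integral>\<^sup>+x. ennreal (sqrt (p x * q x)) \<partial>R"
  have "2 * ennreal (exp (- (h / 2))) \<le> 2 * ?A"
  proof (rule ennreal_le_epsilon)
    fix e :: real assume "0 < e"
    \<comment> \<open>One half of e pays for the weight not being optimal, the other for replacing
      it by a function of counts.\<close>
    then have e: "0 < e / 2" by simp
    obtain \<delta> where \<delta>: "0 < \<delta>" and
      opt: "(\<integral>\<^sup>+x. ennreal (sqrt ((q x + \<delta>) / (p x + \<delta>))) \<partial>density R (\<lambda>x. ennreal (p x))) +
        (\<integral>\<^sup>+x. ennreal (1 / sqrt ((q x + \<delta>) / (p x + \<delta>))) \<partial>density R (\<lambda>x. ennreal (q x)))
        \<le> 2 * ?A + ennreal (e / 2)"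
      by (rule affinity_near_optimal_weight[OF R _ _ pq mass e]) measurable
    define \<psi> where "\<psi> x = sqrt ((q x + \<delta>) / (p x + \<delta>))" for x
    have \<psi>_meas [measurable]: "\<psi> \<in> borel_measurable R" unfolding \<psi>_def by measurable
    \<comment> \<open>The shifted densities lie between \<delta> and 1 + \<delta>, so l and b are
      the extreme values of the root of their quotient.\<close>
    define l where "l = sqrt (\<delta> / (1 + \<delta>))"
    define b where "b = sqrt ((1 + \<delta>) / \<delta>)"
    have l: "0 < l" using \<delta> by (simp add: l_def)
    have \<psi>l: "l \<le> \<psi> x" for x
      unfolding l_def \<psi>_def using \<delta> pq[of x] pq1[of x]
      by (intro real_sqrt_le_mono frac_le) auto
    have \<psi>b: "\<psi> x \<le> b" for x
      unfolding b_def \<psi>_def using \<delta> pq[of x] pq1[of x]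
      by (intro real_sqrt_le_mono frac_le) auto
    have lb: "l \<le> b" using order_trans[OF \<psi>l \<psi>b] .
    \<comment> \<open>The Lipschitz constant from \<open>weighted_sum_perturb\<close>. An L1 error
      below e/(2c) thus costs at most e/2.\<close>
    define c where "c = 1 + 1 / l\<^sup>2"
    have c: "0 < c" using l by (simp add: c_def add_pos_nonneg)
    have "norm (\<psi> x) \<le> b" for x using \<psi>l[of x] \<psi>b[of x] l by simp
    then have "integrable R \<psi>"
      by (intro R.integrable_const_bound[where B = b]) auto
    then have "cylinder_approx S \<nu> R \<psi>"
      by (rule cylinder_approx_integrable[OF R sR sf sets])
    then obtain v where v: "cylinder_fun S \<nu> v" "integrable R v"
      and approx: "(\<integral>\<eta>. \<bar>\<psi> \<eta> - v \<eta>\<bar> \<partial>R) < e / (2 * c)"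
      using \<open>0 < e\<close> c by (elim cylinder_approxD[where e = "e / (2 * c)"]) auto
    show "2 * ennreal (exp (- (h / 2))) \<le> 2 * ?A + ennreal e"
    proof (rule cylinder_fun_counts[OF v(1) sets])
      fix n :: nat and C :: "nat \<Rightarrow> 'a set" and w
      assume n: "0 < n" and C: "\<And>i. C i \<in> fmeasurable \<nu>" and disj: "disjoint_family_on C {..<n}"
        and w [measurable]: "w \<in> borel_measurable (Pi\<^sub>M {..<n} (\<lambda>_. borel))"
        and vw: "\<And>\<eta>. \<eta> \<in> point_patterns S \<Longrightarrow> v \<eta> = w (counts n C \<eta>)"
      have CS: "C i \<in> sets S" for i using C[of i] sets by auto
      let ?a = "\<lambda>i. measure \<Lambda> (C i)" and ?b = "\<lambda>i. measure M (C i)"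
      let ?U = "Pi\<^sub>M {..<n} (\<lambda>_. borel) :: (nat \<Rightarrow> ennreal) measure"
      note dP = counts_density[OF PP(1) n CS disj fin(1)[OF C]]
      note dQ = counts_density[OF PP(2) n CS disj fin(2)[OF C]]
      \<comment> \<open>The approximant \<open>w\<close> may be zero, negative or unbounded.
        Clamping it to [l,b] makes it an admissible weight and moves it no farther from \<psi>,
        whose values lie in this interval.\<close>
      define G where "G x = max l (min b (w x))" for x
      have [measurable]: "G \<in> borel_measurable ?U" unfolding G_def by measurable
      have G: "l \<le> G x" for x by (simp add: G_def)
      have Gpos: "0 < G x" for x using l G[of x] by simp
      define \<phi> where "\<phi> \<eta> = G (counts n C \<eta>)" for \<eta>
      have cnt [measurable]: "counts n C \<in> R \<rightarrow>\<^sub>M ?U"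
        by (rule measurable_counts[OF sR CS])
      have \<phi>_meas [measurable]: "\<phi> \<in> borel_measurable R" unfolding \<phi>_def by measurable
      have cntP: "counts n C \<in> P \<rightarrow>\<^sub>M ?U" "counts n C \<in> Q \<rightarrow>\<^sub>M ?U"
        using cnt unfolding P[symmetric] Q[symmetric] by simp_all
      have "(\<Sum>i<n. (sqrt (?a i) - sqrt (?b i))\<^sup>2) \<le> h"
      proof -
        have "ennreal (\<Sum>i<n. (sqrt (?a i) - sqrt (?b i))\<^sup>2) \<le> ennreal h"
          unfolding h(1)[symmetric]
          using fin[OF C] C disj fg
          by (intro hellinger_wrt_sum_le[where B = C])
            (auto simp: \<Lambda> M intro!: emeasure_eq_ennreal_measure)
        then show ?thesis using h(2) by simp
      qed
      then have "ennreal (exp (- (h / 2))) \<le> ennreal (exp (- ((\<Sum>i<n. (sqrt (?a i) - sqrt (?b i))\<^sup>2) / 2)))"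
        by (intro ennreal_leI) simp
      also have "\<dots> = (\<integral>\<^sup>+x. ennreal (sqrt (poisson_dens_PiM n ?a x * poisson_dens_PiM n ?b x)) \<partial>poisson_base_PiM n)"
        by (rule nn_integral_sqrt_poisson_dens_PiM[symmetric]) auto
      finally have "2 * ennreal (exp (- (h / 2))) \<le>
          2 * (\<integral>\<^sup>+x. ennreal (sqrt (poisson_dens_PiM n ?a x * poisson_dens_PiM n ?b x)) \<partial>poisson_base_PiM n)"
        by (intro mult_left_mono) auto
      also have "\<dots> \<le> (\<integral>\<^sup>+x. ennreal (G x) \<partial>density (poisson_base_PiM n) (\<lambda>x. ennreal (poisson_dens_PiM n ?a x))) +
          (\<integral>\<^sup>+x. ennreal (1 / G x) \<partial>density (poisson_base_PiM n) (\<lambda>x. ennreal (poisson_dens_PiM n ?b x)))"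
        by (rule affinity_le_weighted_sum) (use Gpos in \<open>auto intro!: poisson_dens_PiM_nonneg\<close>)
      also have "\<dots> = (\<integral>\<^sup>+\<eta>. ennreal (\<phi> \<eta>) \<partial>P) + (\<integral>\<^sup>+\<eta>. ennreal (1 / \<phi> \<eta>) \<partial>Q)"
        unfolding dP(1)[symmetric] dQ(1)[symmetric] \<phi>_def
        using cntP by (subst (1 2) nn_integral_distr) auto
      also have "\<dots> \<le> (\<integral>\<^sup>+x. ennreal (\<psi> x) \<partial>P) + (\<integral>\<^sup>+x. ennreal (1 / \<psi> x) \<partial>Q) +
          ennreal c * (\<integral>\<^sup>+x. ennreal \<bar>\<psi> x - \<phi> x\<bar> \<partial>R)"
        unfolding P[symmetric] Q[symmetric] c_def
        by (rule weighted_sum_perturb) (use pq pq1 l \<psi>l G in \<open>auto simp: \<phi>_def\<close>)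
      also have "\<dots> \<le> (2 * ?A + ennreal (e / 2)) + ennreal (e / 2)"
      proof (rule add_mono)
        show "(\<integral>\<^sup>+x. ennreal (\<psi> x) \<partial>P) + (\<integral>\<^sup>+x. ennreal (1 / \<psi> x) \<partial>Q) \<le> 2 * ?A + ennreal (e / 2)"
          using opt by (simp add: P Q \<psi>_def)
        have "(\<integral>\<^sup>+x. ennreal \<bar>\<psi> x - \<phi> x\<bar> \<partial>R) \<le> (\<integral>\<^sup>+x. ennreal \<bar>\<psi> x - v x\<bar> \<partial>R)"
        proof (intro nn_integral_mono ennreal_leI)
          fix x assume "x \<in> space R"
          then have "\<phi> x = max l (min b (v x))" using vw spR by (simp add: \<phi>_def G_def)
          then show "\<bar>\<psi> x - \<phi> x\<bar> \<le> \<bar>\<psi> x - v x\<bar>"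
            using \<psi>l[of x] \<psi>b[of x] by (auto simp: max_def min_def split: if_splits)
        qed
        also have "\<dots> = ennreal (\<integral>x. \<bar>\<psi> x - v x\<bar> \<partial>R)"
          using v(2) \<open>integrable R \<psi>\<close> by (intro nn_integral_eq_integral) auto
        also have "\<dots> \<le> ennreal (e / (2 * c))" using approx by (intro ennreal_leI) simp
        finally have "ennreal c * (\<integral>\<^sup>+x. ennreal \<bar>\<psi> x - \<phi> x\<bar> \<partial>R) \<le> ennreal c * ennreal (e / (2 * c))"
          by (intro mult_left_mono) auto
        also have "\<dots> = ennreal (e / 2)"
          using c \<open>0 < e\<close> by (subst ennreal_mult[symmetric]) auto
        finally show "ennreal c * (\<integral>\<^sup>+x. ennreal \<bar>\<psi> x - \<phi> x\<bar> \<partial>R) \<le> ennreal (e / 2)" .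
      qed
      also have "\<dots> = 2 * ?A + ennreal e"
        using \<open>0 < e\<close> by (simp add: add.assoc ennreal_plus[symmetric] del: ennreal_plus)
      finally show ?thesis .
    qed
  qed
  then show ?thesis by (subst (asm) ennreal_mult_le_mult_iff) auto
qed

theorem theorem5p3:
  fixes S \<Lambda> M :: "'a measure"
    and P\<^sub>\<Lambda> P\<^sub>M :: "'a measure measure"
  assumes "sets \<Lambda> = sets S" and "sigma_finite_measure \<Lambda>"
    and "sets M = sets S" and "sigma_finite_measure M"
    and "poisson_PP S \<Lambda> P\<^sub>\<Lambda>" and "poisson_PP S M P\<^sub>M"
  shows "(hellinger P\<^sub>\<Lambda> P\<^sub>M)\<^sup>2 = 1 - exp_neg_ennreal ((hellinger \<Lambda> M)\<^sup>2)"
proof -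
  \<comment> \<open>Besides dominating both intensities, the sum guarantees that a set of finite
    \<nu>-measure has finite intensity under each of them.\<close>
  define \<nu> where "\<nu> = sum_measure \<Lambda> M"
  have sM: "sets M = sets \<Lambda>" and s\<nu>: "sets \<nu> = sets S" using assms by (simp_all add: \<nu>_def)
  have sf: "sigma_finite_measure \<nu>"
    unfolding \<nu>_def by (rule sigma_finite_sum_measure[OF assms(2,4) sM])
  obtain f where f [measurable]: "f \<in> borel_measurable \<Lambda>" and f01: "\<And>x. 0 \<le> f x" "\<And>x. f x \<le> 1"
    and f\<Lambda>: "density \<nu> (\<lambda>x. ennreal (f x)) = \<Lambda>" and fM: "density \<nu> (\<lambda>x. ennreal (1 - f x)) = M"
    using density_sum_measure[OF assms(2,4) sM] unfolding \<nu>_def by blast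
  have f\<nu> [measurable]: "f \<in> borel_measurable \<nu>" unfolding \<nu>_def by measurable
  have dom\<nu>: "hellinger_dominated \<Lambda> M \<nu> f (\<lambda>x. 1 - f x)"
    using sf f01 f\<Lambda> fM by (simp add: hellinger_dominated_def)
  have fin: "emeasure \<Lambda> B \<noteq> \<infinity>" "emeasure M B \<noteq> \<infinity>" if "B \<in> fmeasurable \<nu>" for B
  proof -
    have "emeasure \<nu> B = emeasure \<Lambda> B + emeasure M B"
      using that unfolding \<nu>_def by (intro emeasure_sum_measure[OF sM]) auto
    then show "emeasure \<Lambda> B \<noteq> \<infinity>" "emeasure M B \<noteq> \<infinity>"
      using that by (auto simp: fmeasurable_def)
  qed
  define R where "R = sum_measure P\<^sub>\<Lambda> P\<^sub>M"
  have prob: "prob_space P\<^sub>\<Lambda>" "prob_space P\<^sub>M" and sP: "sets P\<^sub>M = sets P\<^sub>\<Lambda>"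
    using assms by (auto simp: poisson_PP_def)
  have spP: "space P\<^sub>M = space P\<^sub>\<Lambda>" by (rule sets_eq_imp_space_eq[OF sP])
  note sfP = prob[THEN prob_space_imp_sigma_finite]
  have R: "finite_measure R"
    using prob_space.emeasure_space_1[OF prob(1)] prob_space.emeasure_space_1[OF prob(2)]
    by (intro finite_measureI) (simp add: R_def emeasure_sum_measure[OF sP] spP)
  obtain p where p [measurable]: "p \<in> borel_measurable P\<^sub>\<Lambda>" and p01: "\<And>x. 0 \<le> p x" "\<And>x. p x \<le> 1"
    and pP: "density R (\<lambda>x. ennreal (p x)) = P\<^sub>\<Lambda>" "density R (\<lambda>x. ennreal (1 - p x)) = P\<^sub>M"
    using density_sum_measure[OF sfP sP] unfolding R_def by blast
  have [measurable]: "p \<in> borel_measurable R" unfolding R_def by measurable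
  have domR: "hellinger_dominated P\<^sub>\<Lambda> P\<^sub>M R p (\<lambda>x. 1 - p x)"
    using sigma_finite_sum_measure[OF sfP sP] p01 pP by (simp add: hellinger_dominated_def R_def)
  let ?H = "\<integral>\<^sup>+x. ennreal ((sqrt (f x) - sqrt (1 - f x))\<^sup>2) \<partial>\<nu>"
  obtain \<alpha> where \<alpha>: "0 \<le> \<alpha>" "\<alpha> \<le> 1" and
    A: "(\<integral>\<^sup>+x. ennreal (sqrt (p x * (1 - p x))) \<partial>R) = ennreal \<alpha>"
    and hP: "(hellinger P\<^sub>\<Lambda> P\<^sub>M)\<^sup>2 = ennreal (1 - \<alpha>)"
    by (rule hellinger_power2_affinity[OF domR prob])
  have upper: "\<alpha> \<le> exp (- (r / 2))" if "0 \<le> r" "ennreal r < ?H" for r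
    using poisson_affinity_le[OF s\<nu> sf f\<nu> f01 f\<Lambda> fM fin assms(5,6) domR that] unfolding A by simp
  have "ennreal \<alpha> = exp_neg_ennreal ((hellinger \<Lambda> M)\<^sup>2)"
  proof (cases ?H)
    case top
    have "\<alpha> \<le> 0"
    proof (rule ccontr)
      assume "\<not> \<alpha> \<le> 0"
      then have "0 < \<alpha>" by simp
      \<comment> \<open>With this r the upper bound exp(-r/2) equals \<alpha>/e, which is smaller
        than \<alpha>; r is nonnegative because \<alpha> is at most 1.\<close>
      define r where "r = 2 * (1 - ln \<alpha>)"
      have "0 \<le> r" using \<open>0 < \<alpha>\<close> \<alpha>(2) ln_le_minus_one[of \<alpha>] by (simp add: r_def)
      then have "\<alpha> \<le> exp (- (r / 2))" by (rule upper) (simp add: top)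
      also have "- (r / 2) = ln \<alpha> + - 1" by (simp add: r_def diff_divide_distrib)
      also have "exp \<dots> = \<alpha> * exp (- 1)" using \<open>0 < \<alpha>\<close> by (subst exp_add) simp
      also have "\<dots> < \<alpha>" using \<open>0 < \<alpha>\<close> by simp
      finally show False by simp
    qed
    then show ?thesis
      using \<alpha> by (simp add: hellinger_power2_eq[OF dom\<nu>] top exp_neg_ennreal_def ennreal_top_divide)
  next
    case (real h)
    have "\<alpha> \<le> exp (- (h / 2))"
    \<comment> \<open>The upper bound is available for 0 <= r < h only. For h > 0 it extends to h by
      letting r increase to h; for h = 0 there is no such r, and the bound is just \<alpha> <=
      1.\<close>
    proof (cases "h = 0")
      case False
      then have "0 < h" using real by simp
      show ?thesis
      proof (rule tendsto_lowerbound)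
        show "((\<lambda>r. exp (- (r / 2))) \<longlongrightarrow> exp (- (h / 2))) (at_left h)"
          by (intro tendsto_intros) simp
        show "\<forall>\<^sub>F r in at_left h. \<alpha> \<le> exp (- (r / 2))"
          using eventually_at_left_real[OF \<open>0 < h\<close>]
          by eventually_elim (auto intro!: upper simp: real ennreal_less_iff)
      qed simp
    qed (use \<alpha> in simp)
    moreover have "exp (- (h / 2)) \<le> \<alpha>"
      \<comment> \<open>The open premises are measurability and nonnegativity of 1 - f, and the
        bound 1 - p <= 1.\<close>
      using poisson_affinity_ge[OF s\<nu> sf f\<nu> _ f01(1) _ f\<Lambda> fM fin assms(5,6) domR R p01(2) _ real(2,1)]
        f01(2) p01(1) \<alpha> unfolding A by simp
    moreover have "(hellinger \<Lambda> M)\<^sup>2 = ennreal (h / 2)"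
      unfolding hellinger_power2_eq[OF dom\<nu>] real(2) using divide_ennreal[of h 2] real(1) by simp
    ultimately show ?thesis using real by (simp add: exp_neg_ennreal_def)
  qed
  then show ?thesis
    unfolding hP using \<alpha>(1) by (simp flip: ennreal_minus)
qed

end
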